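(* Let $V$ be a finite-dimensional real vector space with inner product $\langle\cdot,\cdot\rangle$, and let $M,P\colon V\to V$ be symmetric positive definite operators. Let $g\colon V\to(-\infty,+\infty]$ be a proper convex lower semicontinuous function, and let $F\colon\operatorname{dom} g\to V$ be locally Lipschitz continuous and $P$-monotone, i.e. $\langle F(u)-F(v),u-v\rangle_P\ge0$ for all $u,v\in\operatorname{dom} g$. Assume that the solution set $S$ of the variational inequality $$\text{find } z^*\in V\text{ such that }\langle F(z^* ),z-z^*\rangle_P+g(z)-g(z^* )\ge0\quad\forall z\in V$$ is nonempty. Let $\varphi=\frac{\sqrt5+1}{2}$, and choose $z^0,z^1\in V$, $\lambda_0>0$, $\phi\in(1,\varphi]$, $\bar\lambda>0$; set $\bar z^0=z^1$, $\theta_0=1$, $\rho=\frac1\phi+\frac1{\phi^2}$, and for $k\ge1$ let $$\lambda_k=\min\Bigl\{\rho\lambda_{k-1},\ \frac{\phi\,\theta_{k-1}}{4\lambda_{k-1}}\frac{\|z^k-z^{k-1}\|_{MP}^2}{\|F(z^k)-F(z^{k-1})\|_{M^{-1}P}^2},\ \bar\lambda\Bigr\},$$ $$\bar z^k=\frac{(\phi-1)z^k+\bar z^{k-1}}{\phi},\qquad z^{k+1}=\operatorname{prox}^{MP}_{\lambda_kg}\bigl(\bar z^k-\lambda_kM^{-1}F(z^k)\bigr),\qquad\theta_k=\phi\,\frac{\lambda_k}{\lambda_{k-1}}.$$ Then $(z^k)$ and $(\bar z^k)$ converge to a solution of this variational inequality.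
   Context: $\operatorname{dom} g=\{x\in V:g(x)<+\infty\}$. For a symmetric positive definite operator $W$ on $V$: $\langle u,v\rangle_W=\langle Wu,v\rangle$, $\|z\|_W=\langle Wz,z\rangle^{1/2}$, and the generalized proximal operator is $\operatorname{prox}_g^W=(\operatorname{Id}+W^{-1}\partial g)^{-1}$, where $\partial g$ is the convex subdifferential of $g$; thus $\operatorname{prox}^{W}_{\lambda g}=(\operatorname{Id}+\lambda W^{-1}\partial g)^{-1}$ for $\lambda>0$. The same notation is used with $W=MP$ (in $\|\cdot\|_{MP}$ and $\operatorname{prox}^{MP}$) and with $W=M^{-1}P$ (in $\|\cdot\|_{M^{-1}P}$). In the formula for $\lambda_k$ the convention $\frac00=+\infty$ is adopted.
   Formalization: The starting points z^0, z^1 are taken in dom g, since F(z^0) and F(z^1) are otherwise undefined, and MP is assumed symmetric positive definite (i.e. M and P commute), as the MP-norm and MP-proximal operator require. *)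

theory Defs
  imports "HOL-Analysis.Analysis"
begin

definition sym_pos_def :: "('a::real_inner \<Rightarrow> 'a) \<Rightarrow> bool" where
  "sym_pos_def W \<longleftrightarrow>
     linear W \<and> (\<forall>u v. W u \<bullet> v = u \<bullet> W v) \<and> (\<forall>u. u \<noteq> 0 \<longrightarrow> W u \<bullet> u > 0)"

definition inner_wrt :: "('a::real_inner \<Rightarrow> 'a) \<Rightarrow> 'a \<Rightarrow> 'a \<Rightarrow> real" where
  "inner_wrt W u v = W u \<bullet> v"

definition norm_wrt :: "('a::real_inner \<Rightarrow> 'a) \<Rightarrow> 'a \<Rightarrow> real" where
  "norm_wrt W z = sqrt (inner_wrt W z z)"

definition edom :: "('a \<Rightarrow> ereal) \<Rightarrow> 'a set" where
  "edom g = {x. g x < \<infinity>}"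

definition proper :: "('a \<Rightarrow> ereal) \<Rightarrow> bool" where
  "proper g \<longleftrightarrow> (\<forall>x. g x \<noteq> -\<infinity>) \<and> edom g \<noteq> {}"

text \<open>Since \<open>0 * \<infinity> = 0\<close> in \<^typ>\<open>ereal\<close>, the end points \<open>t = 0\<close> and \<open>t = 1\<close> impose nothing on a
  function that never takes the value \<open>-\<infinity>\<close>.\<close>
definition econvex :: "('a::real_vector \<Rightarrow> ereal) \<Rightarrow> bool" where
  "econvex g \<longleftrightarrow> (\<forall>x y. \<forall>t\<in>{0..1::real}.
     g ((1 - t) *\<^sub>R x + t *\<^sub>R y) \<le> ereal (1 - t) * g x + ereal t * g y)"

definition lower_semicont :: "('a::topological_space \<Rightarrow> ereal) \<Rightarrow> bool" where
  "lower_semicont g \<longleftrightarrow> (\<forall>x. g x \<le> Liminf (at x) g)"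

definition locally_lipschitz_on :: "'a::metric_space set \<Rightarrow> ('a \<Rightarrow> 'b::metric_space) \<Rightarrow> bool" where
  "locally_lipschitz_on D F \<longleftrightarrow> (\<forall>x\<in>D. \<exists>r>0. \<exists>L. L-lipschitz_on (ball x r \<inter> D) F)"

definition monotone_wrt :: "('a::real_inner \<Rightarrow> 'a) \<Rightarrow> 'a set \<Rightarrow> ('a \<Rightarrow> 'a) \<Rightarrow> bool" where
  "monotone_wrt P D F \<longleftrightarrow> (\<forall>u\<in>D. \<forall>v\<in>D. inner_wrt P (F u - F v) (u - v) \<ge> 0)"

text \<open>For proper \<open>g\<close> this set is empty at every point outside the domain of \<open>g\<close>.\<close>
definition subdifferential :: "('a::real_inner \<Rightarrow> ereal) \<Rightarrow> 'a \<Rightarrow> 'a set" where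
  "subdifferential g x = {\<xi>. \<forall>y. g y \<ge> g x + ereal (\<xi> \<bullet> (y - x))}"

text \<open>The point \<open>(Id + W\<inverse> \<partial>g)\<inverse> y\<close>. For \<open>W\<close> symmetric positive definite and \<open>g\<close> proper, convex and
  lower semicontinuous, the set-valued operator \<open>Id + W\<inverse> \<partial>g\<close> has a single-valued inverse defined
  on the whole space.\<close>
definition prox :: "('a::real_inner \<Rightarrow> 'a) \<Rightarrow> ('a \<Rightarrow> ereal) \<Rightarrow> 'a \<Rightarrow> 'a" where
  "prox W g y = (THE x. y \<in> {x + inv W \<xi> | \<xi>. \<xi> \<in> subdifferential g x})"

text \<open>A solution lies in the domain of \<open>g\<close>, since \<open>F\<close> is only meaningful there; with \<^term>\<open>g zs\<close>
  finite, the difference \<^term>\<open>g z - g zs\<close> is never of the form \<open>\<infinity> - \<infinity>\<close>.\<close>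
definition VI_solutions ::
    "('a::real_inner \<Rightarrow> 'a) \<Rightarrow> ('a \<Rightarrow> 'a) \<Rightarrow> ('a \<Rightarrow> ereal) \<Rightarrow> 'a set" where
  "VI_solutions P F g =
     {zs \<in> edom g. \<forall>z. ereal (inner_wrt P (F zs) (z - zs)) + (g z - g zs) \<ge> 0}"

text \<open>Quotient of nonnegative reals with the convention \<open>0/0 = \<infinity>\<close>; also \<open>a/0 = \<infinity>\<close> for \<open>a > 0\<close>.
  Division on \<^typ>\<open>ereal\<close> cannot be used, as it gives \<open>0/0 = 0\<close>.\<close>
definition quot :: "real \<Rightarrow> real \<Rightarrow> ereal" where
  "quot a b = (if b = 0 then \<infinity> else ereal (a / b))"

end

theory Submission
  imports Defs
begin

text \<open>With \<open>W = M P = P M\<close> and \<open>A = M\<inverse> F\<close> the scheme is the adaptive golden ratio algorithm for the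
  \<open>W\<close>-monotone operator \<open>A\<close> in the inner product of \<open>W\<close>. For a solution \<open>s\<close> the energy
  \<open>\<phi>/(\<phi>-1) \<parallel>zbar\<^bsub>k\<^esub> - s\<parallel>\<^sup>2 + \<theta>\<^bsub>k-1\<^esub>/2 \<parallel>z\<^bsub>k\<^esub> - z\<^bsub>k-1\<^esub>\<parallel>\<^sup>2\<close> is nonincreasing, and its decrements, including the slack
  in Young's inequality, force \<open>z\<^bsub>k\<^esub> - zbar\<^bsub>k\<^esub> \<rightarrow> 0\<close> without any lower bound on the step sizes.

  The domain of \<open>g\<close> need not be closed, so \<open>F\<close> might fail to be Lipschitz along the bounded orbit.
  However, no point \<open>p\<close> outside the domain is a limit point: near \<open>p\<close> the function \<open>g\<close> is large, which
  pushes \<open>zbar\<^bsub>k\<^esub>\<close> towards every point \<open>y\<close> in the relative interior of the domain, and finitely many such \<open>y\<close>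
  suffice to keep \<open>zbar\<^bsub>k\<^esub>\<close> away from \<open>p\<close>. Thus the orbit closure is a compact subset of the domain, \<open>F\<close> is
  Lipschitz on it, the step sizes are bounded below, limit points are solutions, and the energy at such a
  limit point tends to zero.\<close>

section \<open>The inner product of a positive definite operator\<close>

context
  fixes W :: "'a::euclidean_space \<Rightarrow> 'a"
  assumes W: "sym_pos_def W"
begin

lemma inner_wrt_add_left: "inner_wrt W (x + y) v = inner_wrt W x v + inner_wrt W y v"
  and inner_wrt_diff_left: "inner_wrt W (x - y) v = inner_wrt W x v - inner_wrt W y v"
  and inner_wrt_scaleR_left: "inner_wrt W (a *\<^sub>R x) v = a * inner_wrt W x v"
  and inner_wrt_minus_left: "inner_wrt W (- x) v = - inner_wrt W x v"
  and inner_wrt_add_right: "inner_wrt W v (x + y) = inner_wrt W v x + inner_wrt W v y"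
  and inner_wrt_diff_right: "inner_wrt W v (x - y) = inner_wrt W v x - inner_wrt W v y"
  and inner_wrt_scaleR_right: "inner_wrt W v (a *\<^sub>R x) = a * inner_wrt W v x"
  and inner_wrt_minus_right: "inner_wrt W v (- x) = - inner_wrt W v x"
  using W by (simp_all add: sym_pos_def_def inner_wrt_def linear_add linear_diff linear_cmul
      linear_neg inner_add_left inner_add_right inner_diff_left inner_diff_right)

lemmas inner_wrt_simps = inner_wrt_add_left inner_wrt_diff_left inner_wrt_scaleR_left
  inner_wrt_minus_left inner_wrt_add_right inner_wrt_diff_right inner_wrt_scaleR_right
  inner_wrt_minus_right

lemma inner_wrt_commute: "inner_wrt W u v = inner_wrt W v u"
  using W by (metis sym_pos_def_def inner_wrt_def inner_commute)

lemma inner_wrt_pos: "u \<noteq> 0 \<Longrightarrow> inner_wrt W u u > 0"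
  using W unfolding sym_pos_def_def inner_wrt_def by blast

lemma inner_wrt_zero [simp]: "inner_wrt W 0 v = 0" "inner_wrt W v 0 = 0"
  using inner_wrt_scaleR_left[of 0 0 v] by (auto simp: inner_wrt_def)

lemma inner_wrt_nonneg [simp]: "inner_wrt W u u \<ge> 0"
  using inner_wrt_pos[of u] by (cases "u = 0") auto

lemma inner_wrt_eq_0_iff: "inner_wrt W u u = 0 \<longleftrightarrow> u = 0"
  using inner_wrt_pos[of u] by force

lemma inner_wrt_add_self:
  "inner_wrt W (u + v) (u + v) = inner_wrt W u u + 2 * inner_wrt W u v + inner_wrt W v v"
  by (simp add: inner_wrt_simps inner_wrt_commute[of v u])

lemma inner_wrt_diff_self:
  "inner_wrt W (u - v) (u - v) = inner_wrt W u u - 2 * inner_wrt W u v + inner_wrt W v v"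
  by (simp add: inner_wrt_simps inner_wrt_commute[of v u])

lemma inner_wrt_scaleR_self:
  "inner_wrt W (a *\<^sub>R u) (a *\<^sub>R u) = a\<^sup>2 * inner_wrt W u u"
  by (simp add: inner_wrt_simps power2_eq_square)

lemma inner_wrt_diff_self_le:
  "inner_wrt W (u - v) (u - v) \<le> 2 * inner_wrt W u u + 2 * inner_wrt W v v"
  using inner_wrt_nonneg[of "u + v"] by (simp add: inner_wrt_add_self inner_wrt_diff_self)

lemma inner_wrt_diff_self_commute:
  "inner_wrt W (u - v) (u - v) = inner_wrt W (v - u) (v - u)"
  by (simp add: inner_wrt_diff_self inner_wrt_commute[of v u])

lemma inner_wrt_Cauchy_Schwarz:
  "(inner_wrt W u v)\<^sup>2 \<le> inner_wrt W u u * inner_wrt W v v"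
proof (cases "v = 0")
  case False
  let ?a = "inner_wrt W u v / inner_wrt W v v"
  have p: "inner_wrt W v v > 0" using inner_wrt_pos[OF False] .
  have "0 \<le> inner_wrt W (u - ?a *\<^sub>R v) (u - ?a *\<^sub>R v)" by simp
  also have "\<dots> = inner_wrt W u u - (inner_wrt W u v)\<^sup>2 / inner_wrt W v v"
    using p by (simp add: inner_wrt_diff_self inner_wrt_simps power2_eq_square inner_wrt_commute[of v u] field_simps)
  finally show ?thesis using p by (simp add: field_simps)
qed simp

lemma continuous_on_inner_wrt [continuous_intros]:
  assumes "continuous_on S a" "continuous_on S b"
  shows "continuous_on S (\<lambda>x. inner_wrt W (a x) (b x))"
proof -
  have "bounded_linear W" using W by (simp add: sym_pos_def_def linear_conv_bounded_linear)
  then show ?thesis unfolding inner_wrt_def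
    using assms by (intro continuous_on_inner bounded_linear.continuous_on[of W])
qed

lemma tendsto_inner_wrt [tendsto_intros]:
  assumes "(a \<longlongrightarrow> x) net" "(b \<longlongrightarrow> y) net"
  shows "((\<lambda>i. inner_wrt W (a i) (b i)) \<longlongrightarrow> inner_wrt W x y) net"
proof -
  have "bounded_linear W" using W by (simp add: sym_pos_def_def linear_conv_bounded_linear)
  then show ?thesis unfolding inner_wrt_def
    using assms by (intro tendsto_inner bounded_linear.tendsto[of W])
qed

text \<open>Compactness of the unit sphere makes the minimum of the form there positive, and
  homogeneity of degree two carries the bound to all vectors.\<close>

lemma inner_wrt_lower_bound:
  obtains m where "m > 0" "\<And>x. m * (norm x)\<^sup>2 \<le> inner_wrt W x x"
proof -
  have ne: "sphere (0::'a) 1 \<noteq> {}" by (metis SOME_Basis mem_sphere_0 norm_Basis empty_iff)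
  have "continuous_on (sphere 0 1) (\<lambda>x. inner_wrt W x x)"
    by (intro continuous_intros)
  then obtain x0 where x0: "x0 \<in> sphere 0 1" "\<And>y. y \<in> sphere 0 1 \<Longrightarrow> inner_wrt W x0 x0 \<le> inner_wrt W y y"
    using continuous_attains_inf[OF compact_sphere ne, of "\<lambda>x. inner_wrt W x x"] by blast
  have "inner_wrt W x0 x0 > 0" using x0(1) by (intro inner_wrt_pos) auto
  moreover have "inner_wrt W x0 x0 * (norm x)\<^sup>2 \<le> inner_wrt W x x" for x
  proof (cases "x = 0")
    case False
    have "inner_wrt W x0 x0 \<le> inner_wrt W (x /\<^sub>R norm x) (x /\<^sub>R norm x)"
      using False by (intro x0(2)) simp
    then show ?thesis using False
      by (simp add: inner_wrt_scaleR_self field_simps)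
  qed simp
  ultimately show thesis by (rule that)
qed

lemma inner_wrt_upper_bound:
  obtains K where "K > 0" "\<And>x. inner_wrt W x x \<le> K * (norm x)\<^sup>2"
proof -
  have "bounded_linear W" using W by (simp add: sym_pos_def_def linear_conv_bounded_linear)
  then obtain K where K: "K > 0" "\<And>x. norm (W x) \<le> norm x * K"
    using bounded_linear.pos_bounded by blast
  have "inner_wrt W x x \<le> K * (norm x)\<^sup>2" for x
  proof -
    have "inner_wrt W x x \<le> norm (W x) * norm x"
      unfolding inner_wrt_def by (rule norm_cauchy_schwarz)
    also have "\<dots> \<le> norm x * K * norm x" by (intro mult_right_mono K) simp
    finally show ?thesis by (simp add: power2_eq_square mult.commute mult.left_commute)
  qed
  with K(1) show thesis by (rule that)
qed

lemma tendsto_0_of_inner_wrt: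
  assumes "((\<lambda>i. inner_wrt W (a i) (a i)) \<longlongrightarrow> 0) net"
  shows "(a \<longlongrightarrow> 0) net"
proof -
  obtain m where m: "m > 0" "\<And>x. m * (norm x)\<^sup>2 \<le> inner_wrt W x x"
    using inner_wrt_lower_bound by blast
  have "((\<lambda>i. sqrt (inner_wrt W (a i) (a i) / m)) \<longlongrightarrow> sqrt (0 / m)) net"
    by (intro tendsto_intros assms) (use m in auto)
  then have "((\<lambda>i. sqrt (inner_wrt W (a i) (a i) / m)) \<longlongrightarrow> 0) net" by simp
  moreover have "norm (a i) \<le> sqrt (inner_wrt W (a i) (a i) / m)" for i
    using m by (intro real_le_rsqrt) (simp add: field_simps)
  ultimately show ?thesis
    by (intro Lim_null_comparison[of a]) auto
qed

end

lemma sym_pos_def_bij: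
  fixes W :: "'a::euclidean_space \<Rightarrow> 'a"
  assumes "sym_pos_def W"
  shows "bij W"
proof -
  have lin: "linear W" using assms by (simp add: sym_pos_def_def)
  have "inj W"
    unfolding linear_injective_0[OF lin]
    using inner_wrt_pos[OF assms] by (metis inner_wrt_def inner_zero_left less_irrefl)
  then show ?thesis using lin linear_injective_imp_surjective bij_def by blast
qed

lemma sym_pos_def_inv:
  fixes W :: "'a::euclidean_space \<Rightarrow> 'a"
  assumes "sym_pos_def W"
  shows "W (inv W x) = x" "inv W (W x) = x"
  using sym_pos_def_bij[OF assms] by (simp_all add: bij_def surj_f_inv_f)

section \<open>The proximal operator\<close>

text \<open>Real-valued model of a proper convex lower semicontinuous function: \<open>D\<close> is
  the domain and \<open>f\<close> the finite part. \<open>closed_epigraph\<close> is lower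
  semicontinuity in sublevel form; as it also yields \<open>x \<in> D\<close>, it forbids bounded
  values along a sequence that leaves the domain in the limit.\<close>

locale closed_convex_function =
  fixes D :: "'a::euclidean_space set" and f :: "'a \<Rightarrow> real"
  assumes nonempty: "D \<noteq> {}"
    and convex: "convex_on D f"
    and closed_epigraph: "\<And>X x c. \<lbrakk>\<And>n::nat. X n \<in> D; X \<longlonglongrightarrow> x; \<And>n. f (X n) \<le> c\<rbrakk> \<Longrightarrow> x \<in> D \<and> f x \<le> c"
begin

lemma closed_epigraph_limit:
  assumes X: "\<And>n::nat. X n \<in> D" "X \<longlonglongrightarrow> x" and c: "\<And>n. f (X n) \<le> c n" "c \<longlonglongrightarrow> L"
  shows "x \<in> D \<and> f x \<le> L"
proof -
  have le: "x \<in> D \<and> f x \<le> L + e" if e: "e > 0" for e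
  proof -
    have "\<forall>\<^sub>F n in sequentially. c n < L + e"
      by (rule order_tendstoD(2)[OF c(2)]) (use e in simp)
    then obtain N where N: "\<And>n. n \<ge> N \<Longrightarrow> c n < L + e"
      unfolding eventually_sequentially by blast
    show ?thesis
    proof (rule closed_epigraph)
      show "(\<lambda>n. X (n + N)) \<longlonglongrightarrow> x" using X(2) by (rule LIMSEQ_ignore_initial_segment)
      show "X (n + N) \<in> D" for n by (rule X)
      show "f (X (n + N)) \<le> L + e" for n
        using N[of "n + N"] c(1)[of "n + N"] by simp
    qed
  qed
  have "f x \<le> L" by (rule field_le_epsilon) (use le in auto)
  with le[of 1] show ?thesis by simp
qed

text \<open>Otherwise points of \<open>D\<close> with \<open>f \<le> c\<close> would converge to
  \<open>p\<close>, and closedness would place \<open>p\<close> in \<open>D\<close>.\<close>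

lemma large_near:
  assumes "p \<notin> D"
  obtains \<delta> where "\<delta> > 0" "\<And>u. u \<in> D \<Longrightarrow> norm (u - p) < \<delta> \<Longrightarrow> f u > c"
proof (rule ccontr)
  assume "\<not> thesis"
  with that have "\<exists>u\<in>D. norm (u - p) < \<delta> \<and> f u \<le> c" if "\<delta> > 0" for \<delta>
    using \<open>\<delta> > 0\<close> by (meson not_le)
  then have "\<exists>u\<in>D. norm (u - p) < inverse (real (Suc n)) \<and> f u \<le> c" for n by simp
  then obtain X where X: "\<And>n. X n \<in> D" "\<And>n. norm (X n - p) < inverse (real (Suc n))" "\<And>n. f (X n) \<le> c"
    by metis
  have "(\<lambda>n. X n - p) \<longlonglongrightarrow> 0"
    by (rule Lim_null_comparison[OF _ LIMSEQ_inverse_real_of_nat])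
      (use X(2) in \<open>auto intro!: always_eventually less_imp_le\<close>)
  then have "X \<longlonglongrightarrow> p" by (rule LIM_zero_cancel)
  then have "p \<in> D" using closed_epigraph[of X p c] X by blast
  with assms show False by simp
qed

text \<open>Values tending to minus infinity along a bounded sequence would force \<open>f\<close>
  below every \<open>- real N\<close> at a limit point.\<close>

lemma bounded_below_on_bounded:
  assumes "bounded B"
  shows "\<exists>m. \<forall>x\<in>D \<inter> B. m \<le> f x"
proof (rule ccontr)
  assume "\<not> ?thesis"
  then have "\<exists>x\<in>D \<inter> B. f x < - real n" for n
    by (auto simp: not_le)
  then obtain X where X: "\<And>n. X n \<in> D \<inter> B" "\<And>n. f (X n) < - real n" by metis
  have "range X \<subseteq> B" using X(1) by auto
  then have "bounded (range X)" using assms bounded_subset by blast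
  then obtain x s where s: "strict_mono s" "(X \<circ> s) \<longlonglongrightarrow> x"
    using bounded_imp_convergent_subsequence by blast
  have le: "x \<in> D \<and> f x \<le> - real N" for N
  proof (rule closed_epigraph)
    show "(\<lambda>n. (X \<circ> s) (n + N)) \<longlonglongrightarrow> x" using s(2) by (rule LIMSEQ_ignore_initial_segment)
    show "(X \<circ> s) (n + N) \<in> D" for n using X(1) by simp
    show "f ((X \<circ> s) (n + N)) \<le> - real N" for n
      using X(2)[of "s (n + N)"] seq_suble[OF s(1), of "n + N"] by simp
  qed
  obtain N where "- f x < real N" using reals_Archimedean2 by blast
  with le[of N] show False by simp
qed

text \<open>Convexity transports the lower bound on a unit ball along rays, so \<^term>\<open>f\<close> decreases at most
  linearly; no separation theorem is needed.\<close>
lemma linear_lower_bound: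
  assumes "x0 \<in> D"
  obtains C where "C \<ge> 0" "\<And>x. x \<in> D \<Longrightarrow> f x0 - C * (1 + norm (x - x0)) \<le> f x"
proof -
  obtain m where m: "\<And>x. x \<in> D \<inter> cball x0 1 \<Longrightarrow> m \<le> f x"
    using bounded_below_on_bounded[OF bounded_cball] by blast
  define C where "C = f x0 - m"
  have C: "C \<ge> 0" using m[of x0] assms by (simp add: C_def)
  have "f x0 - C * (1 + norm (x - x0)) \<le> f x" if "x \<in> D" for x
  proof (cases "norm (x - x0) \<le> 1")
    case True
    then have "m \<le> f x" using that by (intro m) (simp add: dist_norm norm_minus_commute)
    moreover have "C * norm (x - x0) \<ge> 0" using C by simp
    ultimately show ?thesis by (simp add: C_def algebra_simps)
  next
    case False
    define s where "s = norm (x - x0)"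
    have s: "s > 1" using False by (simp add: s_def)
    let ?y = "(1 - 1/s) *\<^sub>R x0 + (1/s) *\<^sub>R x"
    have yD: "?y \<in> D"
      using convex_on_imp_convex[OF convex] that assms s by (intro convexD) auto
    have "?y - x0 = (1/s) *\<^sub>R (x - x0)" by (simp add: algebra_simps)
    then have "norm (?y - x0) = 1" using s by (auto simp: s_def)
    then have "m \<le> f ?y" using yD by (intro m) (simp add: dist_norm norm_minus_commute)
    also have "\<dots> \<le> (1 - 1/s) * f x0 + (1/s) * f x"
      using s by (intro convex_onD[OF convex] that assms) auto
    finally have "s * m \<le> s * ((1 - 1/s) * f x0 + (1/s) * f x)" using s by simp
    also have "\<dots> = (s - 1) * f x0 + f x" using s by (simp add: algebra_simps)
    finally have "f x0 - C * s \<le> f x" by (simp add: C_def algebra_simps)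
    then show ?thesis using C by (simp add: s_def algebra_simps)
  qed
  with C show thesis by (rule that)
qed

text \<open>Direct method: minimise \<open>f\<close> plus half the squared \<open>W\<close>-distance
  to \<open>y\<close>, then compare the minimiser with points of the segment towards
  \<open>v\<close>; the second order term vanishes with the segment parameter.\<close>

lemma prox_exists:
  assumes W: "sym_pos_def W"
  obtains x where "x \<in> D" "\<And>v. v \<in> D \<Longrightarrow> inner_wrt W (y - x) (v - x) \<le> f v - f x"
proof -
  define \<Phi> where "\<Phi> x = f x + inner_wrt W (x - y) (x - y) / 2" for x
  obtain x0 where x0: "x0 \<in> D" using nonempty by blast
  obtain C where C: "C \<ge> 0" "\<And>x. x \<in> D \<Longrightarrow> f x0 - C * (1 + norm (x - x0)) \<le> f x"
    using linear_lower_bound[OF x0] by blast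
  obtain m where m: "m > 0" "\<And>x. m * (norm x)\<^sup>2 \<le> inner_wrt W x x"
    using inner_wrt_lower_bound[OF W] by blast
  define e where "e = inner_wrt W (x0 - y) (x0 - y) / 2"
  \<comment> \<open>Beyond distance 1 from \<open>y\<close> the quadratic term outgrows the at most
    linear decrease of \<open>f\<close>; solving for the distance gives this radius for the sublevel
    set of \<open>x0\<close>.\<close>
  define R where "R = max 1 (2 * (C * (2 + norm (y - x0)) + e) / m)"
  have e0: "e \<ge> 0" by (simp add: e_def W)
  have sub: "norm (x - y) \<le> R" if x: "x \<in> D" "\<Phi> x \<le> \<Phi> x0" for x
  proof (cases "norm (x - y) \<le> 1")
    case False
    let ?t = "norm (x - y)"
    have "norm (x - x0) \<le> ?t + norm (y - x0)"
      using norm_triangle_ineq[of "x - y" "y - x0"] by simp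
    then have "C * (1 + norm (x - x0)) \<le> C * (1 + ?t + norm (y - x0))"
      using C(1) by (simp add: mult_left_mono)
    moreover have "f x + m * ?t\<^sup>2 / 2 \<le> f x0 + e"
      using x(2) m(2)[of "x - y"] by (simp add: \<Phi>_def e_def)
    moreover have "f x0 - C * (1 + norm (x - x0)) \<le> f x" by (rule C(2)[OF x(1)])
    ultimately have "m * ?t\<^sup>2 / 2 \<le> C * (1 + ?t + norm (y - x0)) + e" by linarith
    \<comment> \<open>Every term is inflated to a multiple of \<open>?t > 1\<close>, so that one
      factor \<open>?t\<close> cancels.\<close>
    also have "\<dots> \<le> C * ((2 + norm (y - x0)) * ?t) + e * ?t"
    proof (intro add_mono mult_left_mono C(1))
      have "norm (y - x0) * 1 \<le> norm (y - x0) * ?t" using False by (intro mult_left_mono) auto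
      then show "1 + ?t + norm (y - x0) \<le> (2 + norm (y - x0)) * ?t"
        using False by (simp add: algebra_simps)
      show "e \<le> e * ?t" using mult_left_mono[of 1 ?t e] e0 False by simp
    qed
    finally have "(m * ?t / 2) * ?t \<le> (C * (2 + norm (y - x0)) + e) * ?t"
      by (simp add: algebra_simps power2_eq_square)
    then have "m * ?t / 2 \<le> C * (2 + norm (y - x0)) + e"
      using False by (intro mult_right_le_imp_le[of "m * ?t / 2" ?t]) auto
    then show ?thesis using m(1) by (simp add: R_def field_simps le_max_iff_disj)
  qed (simp add: R_def)
  obtain b where b: "\<And>x. x \<in> D \<inter> cball y R \<Longrightarrow> b \<le> f x"
    using bounded_below_on_bounded[OF bounded_cball] by blast
  have lower: "min b (\<Phi> x0) \<le> \<Phi> x" if "x \<in> D" for x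
  proof (cases "\<Phi> x \<le> \<Phi> x0")
    case True
    then have "b \<le> f x" using sub that by (intro b) (simp add: dist_norm norm_minus_commute)
    then show ?thesis using inner_wrt_nonneg[OF W, of "x - y"] unfolding \<Phi>_def by linarith
  qed simp
  define I where "I = Inf (\<Phi> ` D)"
  have bdd: "bdd_below (\<Phi> ` D)" using lower by (auto intro!: bdd_belowI)
  have I_le: "I \<le> \<Phi> x" if "x \<in> D" for x unfolding I_def using bdd that by (simp add: cINF_lower)
  have ex: "\<exists>x\<in>D. \<Phi> x \<le> \<Phi> x0 \<and> \<Phi> x \<le> I + 1 / Suc n" for n
  proof (cases "\<Phi> x0 \<le> I + 1 / Suc n")
    case False
    have "Inf (\<Phi> ` D) < I + 1 / Suc n" by (simp add: I_def)
    then obtain x where "x \<in> D" "\<Phi> x < I + 1 / Suc n"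
      using cInf_lessD[of "\<Phi> ` D"] nonempty by blast
    with False show ?thesis by (intro bexI[of _ x]) auto
  qed (use x0 in auto)
  then obtain X where X: "\<And>n. X n \<in> D" "\<And>n. \<Phi> (X n) \<le> \<Phi> x0" "\<And>n. \<Phi> (X n) \<le> I + 1 / Suc n"
    by metis
  have "bounded (range X)"
    by (rule bounded_subset[OF bounded_cball[of y R]]) (use sub X in \<open>auto simp: dist_norm norm_minus_commute[of y]\<close>)
  then obtain x s where s: "strict_mono s" "(X \<circ> s) \<longlonglongrightarrow> x"
    using bounded_imp_convergent_subsequence by blast
  \<comment> \<open>\<open>f\<close> is only lower semicontinuous, so the limit is taken in the
    upper bounds for \<open>f\<close> and not in \<open>\<Phi>\<close> itself.\<close>
  have "(\<lambda>n. I + 1 / Suc (s n) - inner_wrt W ((X \<circ> s) n - y) ((X \<circ> s) n - y) / 2)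
      \<longlonglongrightarrow> I + 0 - inner_wrt W (x - y) (x - y) / 2"
    by (intro tendsto_add tendsto_diff tendsto_divide tendsto_const tendsto_inner_wrt[OF W] s(2)
        LIMSEQ_subseq_LIMSEQ[OF LIMSEQ_Suc[OF lim_1_over_n] s(1), unfolded comp_def]) auto
  then have lim: "(\<lambda>n. I + 1 / Suc (s n) - inner_wrt W ((X \<circ> s) n - y) ((X \<circ> s) n - y) / 2)
      \<longlonglongrightarrow> I - inner_wrt W (x - y) (x - y) / 2" by simp
  have "x \<in> D \<and> f x \<le> I - inner_wrt W (x - y) (x - y) / 2"
  proof (rule closed_epigraph_limit[OF _ s(2) _ lim])
    show "(X \<circ> s) n \<in> D" for n using X(1) by simp
    show "f ((X \<circ> s) n) \<le> I + 1 / Suc (s n) - inner_wrt W ((X \<circ> s) n - y) ((X \<circ> s) n - y) / 2" for n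
      using X(3)[of "s n"] by (simp add: \<Phi>_def)
  qed
  then have xD: "x \<in> D" and "f x \<le> I - inner_wrt W (x - y) (x - y) / 2" by auto
  then have "\<Phi> x \<le> I" by (simp add: \<Phi>_def)
  then have opt: "\<Phi> x \<le> \<Phi> v" if "v \<in> D" for v using I_le[OF that] by linarith
  have "inner_wrt W (y - x) (v - x) \<le> f v - f x" if v: "v \<in> D" for v
  proof -
    define a where "a = inner_wrt W (v - x) (v - x) / 2"
    have "a \<ge> 0" by (simp add: a_def W)
    have ineq: "inner_wrt W (y - x) (v - x) \<le> f v - f x + t * a" if t: "0 < t" "t < 1" for t
    proof -
      let ?v = "(1 - t) *\<^sub>R x + t *\<^sub>R v"
      have vD: "?v \<in> D" using convex_on_imp_convex[OF convex] v xD t by (intro convexD) auto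
      define p where "p = inner_wrt W (x - y) (v - x)"
      have "?v - y = (x - y) + t *\<^sub>R (v - x)" by (simp add: algebra_simps)
      then have "inner_wrt W (?v - y) (?v - y) / 2
          = inner_wrt W (x - y) (x - y) / 2 + t * p + t\<^sup>2 * a"
        by (simp only: inner_wrt_add_self[OF W] inner_wrt_scaleR_left[OF W]
            inner_wrt_scaleR_right[OF W] a_def p_def power2_eq_square) simp
      moreover have "f ?v \<le> (1 - t) * f x + t * f v"
        using t by (intro convex_onD[OF convex] v xD) auto
      ultimately have "0 \<le> (1 - t) * f x + t * f v - f x + t * p + t\<^sup>2 * a"
        using opt[OF vD] unfolding \<Phi>_def by linarith
      also have "\<dots> = t * (f v - f x + p + t * a)"
        by (simp add: algebra_simps power2_eq_square)
      finally have "0 \<le> f v - f x + p + t * a"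
        using t by (simp add: zero_le_mult_iff)
      moreover have "inner_wrt W (y - x) (v - x) = - p" unfolding p_def
        by (simp add: inner_wrt_diff_left[OF W])
      ultimately show ?thesis by linarith
    qed
    show ?thesis
    proof (rule field_le_epsilon)
      fix \<epsilon> :: real assume \<epsilon>: "\<epsilon> > 0"
      \<comment> \<open>The cap 1/2 keeps \<open>t\<close> below 1, and \<open>a + 1\<close> is
        positive even for \<open>a = 0\<close>; the error \<open>t * a\<close> is then at most
        \<open>\<epsilon>\<close>.\<close>
      define t where "t = min (1/2) (\<epsilon> / (a + 1))"
      have t: "0 < t" "t < 1" using \<epsilon> \<open>a \<ge> 0\<close> by (auto simp: t_def)
      have "t * a \<le> t * (a + 1)" using t by simp
      also have "\<dots> \<le> \<epsilon> / (a + 1) * (a + 1)"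
        using \<open>a \<ge> 0\<close> by (intro mult_right_mono) (auto simp: t_def)
      also have "\<dots> = \<epsilon>" using \<open>a \<ge> 0\<close> by simp
      finally show "inner_wrt W (y - x) (v - x) \<le> f v - f x + \<epsilon>" using ineq[OF t] by linarith
    qed
  qed
  with xD show thesis by (rule that)
qed

end

section \<open>Extended real-valued functions and the resolvent\<close>

lemma ereal_real_edom:
  assumes "proper g" "x \<in> edom g"
  shows "g x = ereal (real_of_ereal (g x))"
  using assms by (auto simp: proper_def edom_def ereal_real)

lemma closed_convex_function_edom:
  fixes g :: "'a::euclidean_space \<Rightarrow> ereal"
  assumes g: "proper g" "econvex g" "lower_semicont g"
  shows "closed_convex_function (edom g) (\<lambda>x. real_of_ereal (g x))"
proof
  let ?f = "\<lambda>x. real_of_ereal (g x)"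
  show "edom g \<noteq> {}" using g(1) by (simp add: proper_def)
  have conv: "g ((1 - t) *\<^sub>R x + t *\<^sub>R y) \<le> ereal ((1 - t) * ?f x + t * ?f y)"
    if "x \<in> edom g" "y \<in> edom g" "0 \<le> t" "t \<le> 1" for x y t
  proof -
    have "g ((1 - t) *\<^sub>R x + t *\<^sub>R y) \<le> ereal (1 - t) * g x + ereal t * g y"
      using g(2) that by (auto simp: econvex_def)
    also have "g x = ereal (?f x)" by (rule ereal_real_edom[OF g(1) that(1)])
    also have "g y = ereal (?f y)" by (rule ereal_real_edom[OF g(1) that(2)])
    finally show ?thesis by simp
  qed
  have convD: "convex (edom g)"
    unfolding convex_alt
  proof (intro ballI allI impI)
    fix x y t assume "x \<in> edom g" "y \<in> edom g" "0 \<le> (t::real) \<and> t \<le> 1"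
    then have "g ((1 - t) *\<^sub>R x + t *\<^sub>R y) \<le> ereal ((1 - t) * ?f x + t * ?f y)" by (intro conv) auto
    then show "(1 - t) *\<^sub>R x + t *\<^sub>R y \<in> edom g"
      unfolding edom_def using le_less_trans by fastforce
  qed
  show "convex_on (edom g) ?f"
  proof (rule convex_onI[OF _ convD])
    fix t x y assume t: "0 < (t::real)" "t < 1" and xy: "x \<in> edom g" "y \<in> edom g"
    let ?z = "(1 - t) *\<^sub>R x + t *\<^sub>R y"
    have "?z \<in> edom g" using convD xy t by (intro convexD) auto
    then have "g ?z = ereal (?f ?z)" by (rule ereal_real_edom[OF g(1)])
    with conv[OF xy, of t] t show "?f ?z \<le> (1 - t) * ?f x + t * ?f y"
      by (metis ereal_less_eq(3) less_imp_le)
  qed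
  show "x \<in> edom g \<and> ?f x \<le> c"
    if X: "\<And>n. X n \<in> edom g" "X \<longlonglongrightarrow> x" "\<And>n. ?f (X n) \<le> c" for X :: "nat \<Rightarrow> 'a" and x c
  proof -
    have "g x \<le> ereal c"
    proof (rule ccontr)
      assume "\<not> g x \<le> ereal c"
      then have less: "ereal c < g x" by simp
      also have "g x \<le> Liminf (at x) g" using g(3) by (simp add: lower_semicont_def)
      finally have "\<forall>\<^sub>F y in at x. ereal c < g y" by (rule less_LiminfD)
      \<comment> \<open>The lower limit concerns a punctured neighbourhood; \<open>less\<close>
        supplies \<open>x\<close> itself, since the sequence may hit its limit.\<close>
      with less have "\<forall>\<^sub>F y in nhds x. ereal c < g y"
        by (auto simp: eventually_at_filter elim!: eventually_mono)
      then have "\<forall>\<^sub>F n in sequentially. ereal c < g (X n)"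
        using X(2) by (rule eventually_compose_filterlim)
      then obtain n where "ereal c < g (X n)"
        using eventually_happens trivial_limit_sequentially by blast
      also have "g (X n) = ereal (?f (X n))" by (rule ereal_real_edom[OF g(1) X(1)])
      finally show False using X(3)[of n] by simp
    qed
    moreover from this have "x \<in> edom g" unfolding edom_def using le_less_trans by fastforce
    ultimately show ?thesis using ereal_real_edom[OF g(1), of x] by (metis ereal_less_eq(3))
  qed
qed

lemma (in closed_convex_function) closed_convex_function_scale:
  assumes "r > 0"
  shows "closed_convex_function D (\<lambda>x. r * f x)"
proof
  show "D \<noteq> {}" by (rule nonempty)
  show "convex_on D (\<lambda>x. r * f x)" using assms convex by (intro convex_on_cmul) auto
  show "x \<in> D \<and> r * f x \<le> c"
    if "\<And>n. X n \<in> D" "X \<longlonglongrightarrow> x" "\<And>n. r * f (X n) \<le> c" for X :: "nat \<Rightarrow> 'a" and x c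
    using closed_epigraph[of X x "c / r"] that assms by (simp add: field_simps)
qed

text \<open>The resolvent inclusion says that \<open>W (y - x)\<close> is a subgradient of
  \<open>r * g\<close> at \<open>x\<close>, which on the domain is this inequality.
  \<open>prox_exists\<close> gives such a point and positive definiteness its uniqueness, so the
  definite description in \<open>prox\<close> denotes it.\<close>

lemma prox_variational_inequality:
  fixes g :: "'a::euclidean_space \<Rightarrow> ereal" and y :: 'a
  assumes W: "sym_pos_def W" and g: "proper g" "econvex g" "lower_semicont g" and r: "r > 0"
  defines "x \<equiv> prox W (\<lambda>u. ereal r * g u) y"
  shows "x \<in> edom g \<and> (\<forall>v\<in>edom g. inner_wrt W (y - x) (v - x)
           \<le> r * (real_of_ereal (g v) - real_of_ereal (g x)))"
proof -
  let ?f = "\<lambda>u. real_of_ereal (g u)" and ?h = "\<lambda>u. ereal r * g u"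
  let ?P = "\<lambda>x. x \<in> edom g \<and> (\<forall>v\<in>edom g. inner_wrt W (y - x) (v - x) \<le> r * (?f v - ?f x))"
  interpret closed_convex_function "edom g" "\<lambda>u. r * ?f u"
    by (intro closed_convex_function.closed_convex_function_scale closed_convex_function_edom g r)
  have h: "?h u = ereal (r * ?f u)" if "u \<in> edom g" for u
    using ereal_real_edom[OF g(1) that] by (metis times_ereal.simps(1))
  have h_inf: "?h u = \<infinity>" if "u \<notin> edom g" for u
    using that r by (auto simp: edom_def)
  have iff: "(\<exists>\<xi>. y = x + inv W \<xi> \<and> \<xi> \<in> subdifferential ?h x) \<longleftrightarrow> ?P x" for x
  proof -
    have "(\<exists>\<xi>. y = x + inv W \<xi> \<and> \<xi> \<in> subdifferential ?h x) \<longleftrightarrow> W (y - x) \<in> subdifferential ?h x"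
      using sym_pos_def_inv[OF W] by (metis add_diff_cancel_left' add.commute diff_add_cancel)
    also have "\<dots> \<longleftrightarrow> ?P x"
    proof (intro iffI conjI ballI)
      assume sub: "W (y - x) \<in> subdifferential ?h x"
      \<comment> \<open>Comparison with a point of finite value excludes the value infinity at
        \<open>x\<close>.\<close>
      obtain v0 where v0: "v0 \<in> edom g" using nonempty by blast
      have "?h x + ereal (W (y - x) \<bullet> (v0 - x)) \<le> ?h v0" using sub by (simp add: subdifferential_def)
      with h[OF v0] h_inf[of x] show x: "x \<in> edom g" by force
      fix v assume v: "v \<in> edom g"
      have "?h x + ereal (W (y - x) \<bullet> (v - x)) \<le> ?h v" using sub by (simp add: subdifferential_def)
      then show "inner_wrt W (y - x) (v - x) \<le> r * (?f v - ?f x)"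
        unfolding h[OF x] h[OF v] by (simp add: inner_wrt_def algebra_simps)
    next
      assume P: "?P x"
      then have x: "x \<in> edom g" by simp
      show "W (y - x) \<in> subdifferential ?h x"
        unfolding subdifferential_def
      proof (intro CollectI allI)
        fix v
        show "?h x + ereal (W (y - x) \<bullet> (v - x)) \<le> ?h v"
        proof (cases "v \<in> edom g")
          case True
          with P have "inner_wrt W (y - x) (v - x) \<le> r * (?f v - ?f x)" by simp
          then show ?thesis unfolding h[OF x] h[OF True] by (simp add: inner_wrt_def algebra_simps)
        next
          case False
          show ?thesis unfolding h_inf[OF False] by simp
        qed
      qed
    qed
    finally show ?thesis .
  qed
  obtain x0 where x0: "x0 \<in> edom g"
    "\<And>v. v \<in> edom g \<Longrightarrow> inner_wrt W (y - x0) (v - x0) \<le> r * ?f v - r * ?f x0"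
    using prox_exists[OF W, of y] by blast
  have P0: "?P x0" using x0 by (simp add: right_diff_distrib)
  have unique: "x1 = x0" if "?P x1" for x1
  proof -
    have "inner_wrt W (y - x1) (x0 - x1) \<le> r * (?f x0 - ?f x1)"
      and "inner_wrt W (y - x0) (x1 - x0) \<le> r * (?f x1 - ?f x0)"
      using that P0 by blast+
    \<comment> \<open>Adding the two inequalities cancels the function values and leaves the squared
      distance.\<close>
    then have "inner_wrt W (y - x1) (x0 - x1) + inner_wrt W (y - x0) (x1 - x0) \<le> 0"
      by (simp add: right_diff_distrib)
    also have "inner_wrt W (y - x1) (x0 - x1) + inner_wrt W (y - x0) (x1 - x0)
        = inner_wrt W (x0 - x1) (x0 - x1)"
      by (simp add: inner_wrt_diff_left[OF W] inner_wrt_diff_right[OF W])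
    finally show ?thesis
      using inner_wrt_nonneg[OF W, of "x0 - x1"] inner_wrt_eq_0_iff[OF W, of "x0 - x1"] by simp
  qed
  have "x = (THE x. ?P x)"
    unfolding x_def prox_def mem_Collect_eq iff ..
  also have "\<dots> = x0" using P0 unique by (rule the_equality)
  finally show ?thesis using P0 by simp
qed

section \<open>The golden ratio iteration\<close>

text \<open>Abstract form of the scheme in a single inner product, with divisions cleared so that
  zero denominators need no convention. \<open>theta_le\<close> reflects
  \<open>phi * rho = 1 + 1 / phi\<close>, and \<open>step_size\<close> is the middle entry of the
  minimum, multiplied out by means of \<open>theta_Suc\<close>.\<close>

locale golden_ratio_iteration = closed_convex_function D f
  for D :: "'a::euclidean_space set" and f :: "'a \<Rightarrow> real" +
  fixes W A :: "'a \<Rightarrow> 'a" and z zbar :: "nat \<Rightarrow> 'a" and lam theta :: "nat \<Rightarrow> real"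
    and phi :: real
  assumes W: "sym_pos_def W"
    and A_mono: "\<And>u v. u \<in> D \<Longrightarrow> v \<in> D \<Longrightarrow> inner_wrt W (A u - A v) (u - v) \<ge> 0"
    and phi_gt_1: "phi > 1"
    and z_in_D: "\<And>k. z k \<in> D"
    and zbar_in_D: "\<And>k. zbar k \<in> D"
    and lam_pos: "\<And>k. lam k > 0"
    and theta_pos: "\<And>k. theta k > 0"
    and zbar_Suc: "\<And>k. phi *\<^sub>R zbar (Suc k) = (phi - 1) *\<^sub>R z (Suc k) + zbar k"
    and theta_Suc: "\<And>k. theta (Suc k) * lam k = phi * lam (Suc k)"
    and theta_le: "\<And>k. theta (Suc k) \<le> 1 + 1 / phi"
    and step_size: "\<And>k. 4 * (lam (Suc k))\<^sup>2 * inner_wrt W (A (z (Suc k)) - A (z k)) (A (z (Suc k)) - A (z k))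
        \<le> theta (Suc k) * theta k * inner_wrt W (z (Suc k) - z k) (z (Suc k) - z k)"
    and prox_step: "\<And>k v. v \<in> D \<Longrightarrow>
        inner_wrt W (zbar (Suc k) - lam (Suc k) *\<^sub>R A (z (Suc k)) - z (Suc (Suc k))) (v - z (Suc (Suc k)))
        \<le> lam (Suc k) * (f v - f (z (Suc (Suc k))))"
begin

section \<open>The energy and its decrease\<close>

abbreviation q :: "'a \<Rightarrow> real" where "q v \<equiv> inner_wrt W v v"

definition sol :: "'a \<Rightarrow> bool" where
  "sol s \<longleftrightarrow> s \<in> D \<and> (\<forall>v\<in>D. inner_wrt W (A s) (v - s) + f v - f s \<ge> 0)"

text \<open>With the square root, the remainder in Young's inequality is a full square
  \<open>(\<beta> (Suc n) - \<beta> n)\<^sup>2\<close> that can be kept.\<close>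

definition \<beta> :: "nat \<Rightarrow> real" where
  "\<beta> n = sqrt (theta n * q (z (Suc n) - z n))"

text \<open>The weight is inverse to the factor in \<open>zbar_diff'\<close>, so the cross term of
  the expanded square appears with coefficient 2.\<close>

definition energy :: "'a \<Rightarrow> nat \<Rightarrow> real" where
  "energy s n = phi / (phi - 1) * q (zbar (Suc n) - s) + (\<beta> n)\<^sup>2 / 2"

lemma \<beta>_nonneg: "\<beta> n \<ge> 0"
  using theta_pos[of n] by (simp add: \<beta>_def W)

lemma \<beta>_square: "(\<beta> n)\<^sup>2 = theta n * q (z (Suc n) - z n)"
  using theta_pos[of n] by (simp add: \<beta>_def W)

lemma energy_nonneg: "energy s n \<ge> 0"
  using phi_gt_1 by (simp add: energy_def W)

lemma z_minus_zbar: "z (Suc k) - zbar k = phi *\<^sub>R (z (Suc k) - zbar (Suc k))"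
  using zbar_Suc[of k] by (simp add: algebra_simps)

lemma zbar_diff: "zbar (Suc k) - zbar k = (phi - 1) *\<^sub>R (z (Suc k) - zbar (Suc k))"
  using zbar_Suc[of k] by (simp add: algebra_simps)

lemma zbar_diff': "zbar (Suc k) - zbar k = ((phi - 1) / phi) *\<^sub>R (z (Suc k) - zbar k)"
  using phi_gt_1 by (simp add: zbar_diff z_minus_zbar)

text \<open>Here \<open>h\<close> stands for \<open>zbar (Suc n)\<close> minus the solution, and
  \<open>s\<close>, \<open>u\<close> for the new and the current iterate minus
  \<open>zbar (Suc n)\<close>. The prox inequality tested at the solution, the preceding one tested
  at the new iterate and scaled by \<open>l / l'\<close>, and the solution inequality scaled by
  \<open>l\<close> are combined; all function values cancel.\<close>

lemma energy_inequality_vectors: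
  assumes p1: "inner_wrt W (- s - l *\<^sub>R a) (- (s + h)) \<le> l * (gs - g2)"
    and p2: "inner_wrt W (- (phi *\<^sub>R u) - l' *\<^sub>R a') (s - u) \<le> l' * (g2 - g1)"
    and vi: "inner_wrt W a (u + h) \<ge> gs - g1"
    and th: "th * l' = phi * l" and l: "l > 0" "l' > 0"
  shows "2 * inner_wrt W h s \<le> - 2 * q s + th * (q s - q u - q (s - u)) - 2 * l * inner_wrt W (a - a') (s - u)"
proof -
  have "- (phi * inner_wrt W u (s - u)) - l' * inner_wrt W a' (s - u) \<le> l' * (g2 - g1)"
    using p2 by (simp only: inner_wrt_diff_left[OF W] inner_wrt_minus_left[OF W] inner_wrt_scaleR_left[OF W])
  then have "l / l' * (- (phi * inner_wrt W u (s - u)) - l' * inner_wrt W a' (s - u)) \<le> l / l' * (l' * (g2 - g1))"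
    using l by (intro mult_left_mono) auto
  moreover have "l / l' * (- (phi * inner_wrt W u (s - u)) - l' * inner_wrt W a' (s - u))
      = - (th * inner_wrt W u (s - u)) - l * inner_wrt W a' (s - u)"
  proof -
    have "th = phi * l / l'" using th l by (simp add: field_simps)
    then show ?thesis using l by (simp add: field_simps)
  qed
  ultimately have p2': "- (th * inner_wrt W u (s - u)) - l * inner_wrt W a' (s - u) \<le> l * g2 - l * g1"
    using l by (simp add: algebra_simps)
  have p1': "q s + inner_wrt W h s + l * inner_wrt W a s + l * inner_wrt W a h \<le> l * gs - l * g2"
    using p1 by (simp add: inner_wrt_simps[OF W] inner_wrt_commute[OF W, of s h] algebra_simps)
  have vi': "l * gs - l * g1 \<le> l * inner_wrt W a u + l * inner_wrt W a h"
    using mult_left_mono[OF vi, of l] l by (simp add: inner_wrt_simps[OF W] algebra_simps)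
  have "2 * inner_wrt W u (s - u) = q s - q u - q (s - u)"
    by (simp add: inner_wrt_simps[OF W] inner_wrt_commute[OF W, of s u])
  then have e: "th * (q s - q u - q (s - u)) = 2 * (th * inner_wrt W u (s - u))"
    by (metis mult.left_commute)
  have "l * inner_wrt W (a - a') (s - u)
      = l * inner_wrt W a s - l * inner_wrt W a u - l * inner_wrt W a' (s - u)"
    by (simp add: inner_wrt_diff_left[OF W] inner_wrt_diff_right[OF W] algebra_simps)
  with p1' p2' vi' e show ?thesis by linarith
qed

text \<open>Expanding the square of \<open>zbar (Suc (Suc n)) - s\<close> reduces the claim to
  \<open>energy_inequality_vectors\<close>; the remaining difference of operator values is absorbed
  by Cauchy-Schwarz and \<open>step_size\<close>.\<close>

lemma energy_Suc:
  assumes s: "sol s" and n: "n > 0"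
  shows "energy s (Suc n) \<le> energy s n - theta (Suc n) * q (z (Suc n) - zbar (Suc n))
     - (1 + 1 / phi - theta (Suc n)) * q (z (Suc (Suc n)) - zbar (Suc n)) - (\<beta> (Suc n) - \<beta> n)\<^sup>2 / 2"
proof -
  \<comment> \<open>The prox inequality that produced \<open>z (Suc n)\<close> is
    \<open>prox_step\<close> at index \<open>n - 1\<close>, hence the restriction to positive
    \<open>n\<close>.\<close>
  obtain m where m: "n = Suc m" using n by (cases n) auto
  define h u r where "h = zbar (Suc n) - s" and "u = z (Suc n) - zbar (Suc n)"
    and "r = z (Suc (Suc n)) - zbar (Suc n)"
  define l th dA where "l = lam (Suc n)" and "th = theta (Suc n)"
    and "dA = A (z (Suc n)) - A (z n)"
  have sD: "s \<in> D" using s by (simp add: sol_def)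
  have "inner_wrt W (- r - l *\<^sub>R A (z (Suc n))) (- (r + h)) \<le> l * (f s - f (z (Suc (Suc n))))"
    using prox_step[OF sD, of n] by (simp add: r_def l_def h_def algebra_simps)
  moreover have "inner_wrt W (- (phi *\<^sub>R u) - lam n *\<^sub>R A (z n)) (r - u) \<le> lam n * (f (z (Suc (Suc n))) - f (z (Suc n)))"
  proof -
    have eq: "zbar n - lam n *\<^sub>R A (z n) - z (Suc n) = - (phi *\<^sub>R u) - lam n *\<^sub>R A (z n)"
      unfolding u_def z_minus_zbar[symmetric] by simp
    have "inner_wrt W (zbar n - lam n *\<^sub>R A (z n) - z (Suc n)) (z (Suc (Suc n)) - z (Suc n))
        \<le> lam n * (f (z (Suc (Suc n))) - f (z (Suc n)))"
      using prox_step[OF z_in_D, of m "Suc (Suc n)"] by (simp add: m[symmetric])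
    then show ?thesis unfolding eq by (simp add: r_def u_def)
  qed
  moreover have "inner_wrt W (A (z (Suc n))) (u + h) \<ge> f s - f (z (Suc n))"
  proof -
    have "inner_wrt W (A s) (z (Suc n) - s) + f (z (Suc n)) - f s \<ge> 0"
      using s z_in_D by (simp add: sol_def)
    moreover have "inner_wrt W (A (z (Suc n)) - A s) (z (Suc n) - s) \<ge> 0"
      by (intro A_mono z_in_D sD)
    ultimately show ?thesis by (simp add: inner_wrt_diff_left[OF W] u_def h_def)
  qed
  ultimately have main: "2 * inner_wrt W h r \<le> - 2 * q r + th * (q r - q u - q (r - u))
      - 2 * l * inner_wrt W dA (r - u)"
    unfolding dA_def
    by (intro energy_inequality_vectors[where l' = "lam n"]) (simp_all add: theta_Suc th_def l_def lam_pos)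
  have ru: "r - u = z (Suc (Suc n)) - z (Suc n)" by (simp add: r_def u_def)
  have b: "(\<beta> (Suc n))\<^sup>2 = th * q (r - u)" by (simp add: \<beta>_square ru th_def)
  have young: "- 2 * l * inner_wrt W dA (r - u) \<le> \<beta> n * \<beta> (Suc n)"
  proof (rule power2_le_imp_le)
    have "(- 2 * l * inner_wrt W dA (r - u))\<^sup>2 = 4 * l\<^sup>2 * (inner_wrt W dA (r - u))\<^sup>2"
      by (simp add: power_mult_distrib)
    also have "\<dots> \<le> 4 * l\<^sup>2 * (q dA * q (r - u))"
      by (intro mult_left_mono inner_wrt_Cauchy_Schwarz W) auto
    also have "\<dots> = (4 * l\<^sup>2 * q dA) * q (r - u)" by simp
    also have "\<dots> \<le> (th * theta n * q (z (Suc n) - z n)) * q (r - u)"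
      unfolding dA_def l_def th_def by (intro mult_right_mono step_size) (simp add: W)
    also have "\<dots> = (\<beta> n * \<beta> (Suc n))\<^sup>2" by (simp add: power_mult_distrib b \<beta>_square[of n])
    finally show "(- 2 * l * inner_wrt W dA (r - u))\<^sup>2 \<le> (\<beta> n * \<beta> (Suc n))\<^sup>2" .
  qed (simp add: \<beta>_nonneg)
  have "zbar (Suc (Suc n)) - s = h + (zbar (Suc (Suc n)) - zbar (Suc n))" by (simp add: h_def)
  then have "zbar (Suc (Suc n)) - s = h + ((phi - 1) / phi) *\<^sub>R r" by (simp only: zbar_diff' r_def)
  then have "q (zbar (Suc (Suc n)) - s)
      = q h + 2 * ((phi - 1) / phi * inner_wrt W h r) + ((phi - 1) / phi)\<^sup>2 * q r"
    by (simp only: inner_wrt_add_self[OF W] inner_wrt_scaleR_left[OF W] inner_wrt_scaleR_right[OF W]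
        power2_eq_square mult.assoc)
  moreover have "phi / (phi - 1) * (a + 2 * ((phi - 1) / phi * b) + ((phi - 1) / phi)\<^sup>2 * c)
      = phi / (phi - 1) * a + 2 * b + (1 - 1 / phi) * c" for a b c :: real
    using phi_gt_1 by (simp add: field_simps power2_eq_square)
  ultimately have "phi / (phi - 1) * q (zbar (Suc (Suc n)) - s)
      = phi / (phi - 1) * q h + 2 * inner_wrt W h r + (1 - 1 / phi) * q r"
    by simp
  then have E1: "energy s (Suc n)
      = phi / (phi - 1) * q h + 2 * inner_wrt W h r + (1 - 1 / phi) * q r + (\<beta> (Suc n))\<^sup>2 / 2"
    by (simp only: energy_def)
  have E0: "energy s n = phi / (phi - 1) * q h + (\<beta> n)\<^sup>2 / 2" by (simp only: energy_def h_def)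
  \<comment> \<open>An identity in place of Young's inequality: its last square is the slack used
    later for convergence.\<close>
  have "\<beta> n * \<beta> (Suc n) = (\<beta> n)\<^sup>2 / 2 + (\<beta> (Suc n))\<^sup>2 / 2 - (\<beta> (Suc n) - \<beta> n)\<^sup>2 / 2"
    by (simp add: power2_eq_square field_simps)
  moreover have "(1 - 1 / phi) * q r = q r - q r / phi"
    and "(1 + 1 / phi - th) * q r = q r + q r / phi - th * q r"
    and "th * (q r - q u - q (r - u)) = th * q r - th * q u - th * q (r - u)"
    by (simp_all add: algebra_simps)
  ultimately have "energy s (Suc n) \<le> energy s n - th * q u - (1 + 1 / phi - th) * q r
      - (\<beta> (Suc n) - \<beta> n)\<^sup>2 / 2"
    using main young b E1 E0 by linarith
  then show ?thesis by (simp only: u_def r_def th_def)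
qed

lemma energy_antimono:
  assumes "sol s" "0 < m" "m \<le> n"
  shows "energy s n \<le> energy s m"
  using assms(3)
proof (induction rule: dec_induct)
  case (step k)
  have "0 \<le> theta (Suc k) * q (z (Suc k) - zbar (Suc k))"
    using theta_pos[of "Suc k"] by (simp add: W)
  moreover have "0 \<le> (1 + 1 / phi - theta (Suc k)) * q (z (Suc (Suc k)) - zbar (Suc k))"
    using theta_le[of k] by (simp add: W)
  moreover have "k > 0" using step assms(2) by simp
  ultimately show ?case
    using energy_Suc[OF assms(1), of k] step.IH zero_le_power2[of "\<beta> (Suc k) - \<beta> k"] by linarith
qed simp

section \<open>Boundedness and vanishing residuals\<close>

lemma zbar_bounded:
  assumes "sol s"
  shows "bounded (range zbar)"
proof -
  obtain m where m: "m > 0" "\<And>x. m * (norm x)\<^sup>2 \<le> q x" using inner_wrt_lower_bound[OF W] by blast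
  define R where "R = sqrt ((energy s 1) / m)"
  have "norm (zbar (Suc n) - s) \<le> R" if "n > 0" for n
  proof -
    have "1 * q (zbar (Suc n) - s) \<le> phi / (phi - 1) * q (zbar (Suc n) - s)"
      using phi_gt_1 by (intro mult_right_mono) (auto simp: W)
    also have "\<dots> \<le> energy s n" by (simp add: energy_def)
    also have "\<dots> \<le> energy s 1" using that by (intro energy_antimono assms) auto
    finally have "m * (norm (zbar (Suc n) - s))\<^sup>2 \<le> energy s 1" using m(2) by (metis mult_1 order_trans)
    then show ?thesis unfolding R_def using m(1) by (intro real_le_rsqrt) (simp add: field_simps)
  qed
  then have "zbar n \<in> cball s R" if "n \<ge> 2" for n
    using that by (cases n) (auto simp: dist_norm norm_minus_commute[of s])
  then have "range zbar \<subseteq> cball s R \<union> zbar ` {..<2}"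
    by (meson Un_iff image_eqI image_subsetI lessThan_iff not_le)
  moreover have "bounded (cball s R \<union> zbar ` {..<2})"
    by (simp add: finite_imp_bounded)
  ultimately show ?thesis using bounded_subset by blast
qed

lemma energy_convergent:
  assumes "sol s"
  obtains L where "energy s \<longlonglongrightarrow> L"
proof -
  have "decseq (\<lambda>n. energy s (Suc n))"
    by (intro decseq_SucI energy_antimono assms) auto
  then obtain L where "(\<lambda>n. energy s (Suc n)) \<longlonglongrightarrow> L"
    by (rule decseq_convergent[where B = 0]) (auto intro: energy_nonneg)
  then show thesis by (rule that[OF LIMSEQ_imp_Suc])
qed

lemma energy_decrement_tendsto_0:
  assumes "sol s"
  shows "(\<lambda>n. energy s n - energy s (Suc n)) \<longlonglongrightarrow> 0"
proof -
  obtain L where L: "energy s \<longlonglongrightarrow> L" using energy_convergent[OF assms] .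
  from tendsto_diff[OF L LIMSEQ_Suc[OF L]] show ?thesis by simp
qed

text \<open>No lower bound on the step sizes is available yet, so \<^term>\<open>theta n\<close> may be arbitrarily small.
  A small \<^term>\<open>theta (Suc n)\<close> leaves the coefficient \<open>1 + 1/\<phi> - \<theta>\<close> large, a large one makes the
  term \<open>\<theta> q (z - zbar)\<close> effective; either way \<^term>\<open>\<beta> (Suc n)\<close> is controlled by two decrements.\<close>
lemma \<beta>_le_energy_decrements:
  assumes s: "sol s"
  shows "(\<beta> (Suc (Suc (Suc n))))\<^sup>2 \<le> (8 * phi\<^sup>2 + 4) * (energy s (Suc (Suc n)) - energy s (Suc (Suc (Suc n))))
      + 4 * (energy s (Suc n) - energy s (Suc (Suc n)))"
proof -
  define d where "d k = energy s k - energy s (Suc k)" for k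
  define u where "u k = z k - zbar k" for k
  define \<sigma> where "\<sigma> = 1 + 1 / phi"
  have \<sigma>: "\<sigma> > 1" using phi_gt_1 by (simp add: \<sigma>_def)
  have th: "theta (Suc k) > 0" "theta (Suc k) \<le> \<sigma>" for k
    using theta_pos theta_le by (simp_all add: \<sigma>_def)
  have qn: "q v \<ge> 0" for v by (simp add: W)
  have r: "z (Suc (Suc k)) - zbar (Suc k) = phi *\<^sub>R u (Suc (Suc k))" for k
    by (simp add: u_def z_minus_zbar)
  have dec: "theta (Suc k) * q (u (Suc k)) + (\<sigma> - theta (Suc k)) * (phi\<^sup>2 * q (u (Suc (Suc k))))
      + (\<beta> (Suc k) - \<beta> k)\<^sup>2 / 2 \<le> d k" if "k > 0" for k
    using energy_Suc[OF s that]
    unfolding d_def r inner_wrt_scaleR_self[OF W] \<sigma>_def u_def by linarith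
  have nn: "theta (Suc k) * q (u (Suc k)) \<ge> 0" "(\<sigma> - theta (Suc k)) * (phi\<^sup>2 * q (u (Suc (Suc k)))) \<ge> 0" for k
    using th[of k] qn by simp_all
  have d1: "theta (Suc k) * q (u (Suc k)) \<le> d k"
    and d2: "(\<sigma> - theta (Suc k)) * (phi\<^sup>2 * q (u (Suc (Suc k)))) \<le> d k"
    and d3: "(\<beta> (Suc k) - \<beta> k)\<^sup>2 \<le> 2 * d k" if "k > 0" for k
    using dec[OF that] nn[of k] zero_le_power2[of "\<beta> (Suc k) - \<beta> k"] by linarith+
  have d0: "d k \<ge> 0" if "k > 0" for k
    using d1[OF that] nn(1)[of k] by linarith
  have b: "(\<beta> (Suc k))\<^sup>2 \<le> 2 * (theta (Suc k) * (phi\<^sup>2 * q (u (Suc (Suc k))))) + 2 * d k" if "k > 0" for k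
  proof -
    have "z (Suc (Suc k)) - z (Suc k) = phi *\<^sub>R u (Suc (Suc k)) - u (Suc k)"
      using r[of k] by (simp add: u_def algebra_simps)
    then have "q (z (Suc (Suc k)) - z (Suc k)) \<le> 2 * (phi\<^sup>2 * q (u (Suc (Suc k)))) + 2 * q (u (Suc k))"
      using inner_wrt_diff_self_le[OF W, of "phi *\<^sub>R u (Suc (Suc k))" "u (Suc k)"]
      by (simp add: inner_wrt_scaleR_self[OF W])
    then have "(\<beta> (Suc k))\<^sup>2 \<le> theta (Suc k) * (2 * (phi\<^sup>2 * q (u (Suc (Suc k)))) + 2 * q (u (Suc k)))"
      unfolding \<beta>_square using th(1)[of k] by (intro mult_left_mono) auto
    also have "\<dots> = 2 * (theta (Suc k) * (phi\<^sup>2 * q (u (Suc (Suc k))))) + 2 * (theta (Suc k) * q (u (Suc k)))"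
      by (simp add: algebra_simps)
    finally show ?thesis using d1[OF that] by linarith
  qed
  let ?k = "Suc (Suc n)"
  have "(\<beta> (Suc ?k))\<^sup>2 \<le> (8 * phi\<^sup>2 + 4) * d ?k + 4 * d (Suc n)"
  proof (cases "theta (Suc ?k) \<le> \<sigma> / 2")
    case True
    have "theta (Suc ?k) * (phi\<^sup>2 * q (u (Suc (Suc ?k)))) \<le> (\<sigma> - theta (Suc ?k)) * (phi\<^sup>2 * q (u (Suc (Suc ?k))))"
      using True qn by (intro mult_right_mono) auto
    also have "\<dots> \<le> d ?k" by (rule d2) simp
    finally have "(\<beta> (Suc ?k))\<^sup>2 \<le> 4 * d ?k" using b[of ?k] by simp
    also have "\<dots> \<le> (8 * phi\<^sup>2 + 4) * d ?k" using d0[of ?k] by (intro mult_right_mono) auto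
    finally show ?thesis using d0[of "Suc n"] by linarith
  next
    case False
    \<comment> \<open>A large \<open>theta (Suc ?k)\<close> bounds \<open>q (u (Suc ?k))\<close>,
      the vector in estimate \<open>b\<close> one index earlier; \<open>d3\<close> then passes from
      \<open>\<beta> ?k\<close> to \<open>\<beta> (Suc ?k)\<close>. Doubling both bounds gives the
      constants \<open>8 * phi\<^sup>2 + 4\<close> and 4.\<close>
    have "\<sigma> / 2 * q (u (Suc ?k)) \<le> theta (Suc ?k) * q (u (Suc ?k))"
      using False qn by (intro mult_right_mono) auto
    also have "\<dots> \<le> d ?k" by (rule d1) simp
    finally have u: "\<sigma> * q (u (Suc ?k)) \<le> 2 * d ?k" by simp
    have "theta ?k * (phi\<^sup>2 * q (u (Suc ?k))) \<le> \<sigma> * (phi\<^sup>2 * q (u (Suc ?k)))"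
      using th qn by (intro mult_right_mono) auto
    also have "\<dots> = phi\<^sup>2 * (\<sigma> * q (u (Suc ?k)))" by simp
    also have "\<dots> \<le> phi\<^sup>2 * (2 * d ?k)" by (intro mult_left_mono u) simp
    finally have "(\<beta> ?k)\<^sup>2 \<le> 4 * phi\<^sup>2 * d ?k + 2 * d (Suc n)" using b[of "Suc n"] by simp
    moreover have "(\<beta> (Suc ?k))\<^sup>2 \<le> 2 * (\<beta> ?k)\<^sup>2 + 2 * (\<beta> (Suc ?k) - \<beta> ?k)\<^sup>2"
    proof -
      have "0 \<le> (\<beta> (Suc ?k) - 2 * \<beta> ?k)\<^sup>2" by simp
      then show ?thesis by (simp add: power2_eq_square algebra_simps)
    qed
    moreover have "(\<beta> (Suc ?k) - \<beta> ?k)\<^sup>2 \<le> 2 * d ?k" by (rule d3) simp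
    ultimately show ?thesis by (simp add: algebra_simps)
  qed
  then show ?thesis by (simp add: d_def)
qed

lemma \<beta>_tendsto_0:
  assumes "sol s"
  shows "(\<lambda>n. (\<beta> n)\<^sup>2) \<longlonglongrightarrow> 0"
proof -
  let ?d = "\<lambda>n. energy s n - energy s (Suc n)"
  have d: "(\<lambda>n. ?d (Suc n)) \<longlonglongrightarrow> 0" "(\<lambda>n. ?d (Suc (Suc n))) \<longlonglongrightarrow> 0"
    using LIMSEQ_Suc[OF energy_decrement_tendsto_0[OF assms]]
      LIMSEQ_Suc[OF LIMSEQ_Suc[OF energy_decrement_tendsto_0[OF assms]]] by auto
  have "(\<lambda>n. (8 * phi\<^sup>2 + 4) * ?d (Suc (Suc n)) + 4 * ?d (Suc n)) \<longlonglongrightarrow> (8 * phi\<^sup>2 + 4) * 0 + 4 * 0"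
    by (intro tendsto_add tendsto_mult tendsto_const d)
  then have lim: "(\<lambda>n. (8 * phi\<^sup>2 + 4) * ?d (Suc (Suc n)) + 4 * ?d (Suc n)) \<longlonglongrightarrow> 0" by simp
  have "(\<lambda>n. (\<beta> (Suc (Suc (Suc n))))\<^sup>2) \<longlonglongrightarrow> 0"
    by (rule tendsto_sandwich[OF _ _ tendsto_const lim])
      (intro always_eventually allI zero_le_power2 \<beta>_le_energy_decrements[OF assms])+
  then show ?thesis
    by (intro LIMSEQ_imp_Suc[of "\<lambda>n. (\<beta> n)\<^sup>2"] LIMSEQ_imp_Suc[of "\<lambda>n. (\<beta> (Suc n))\<^sup>2"]
        LIMSEQ_imp_Suc[of "\<lambda>n. (\<beta> (Suc (Suc n)))\<^sup>2"])
qed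

text \<open>The decrement controls \<open>q (?r k)\<close> only with the factor
  \<open>1 + 1 / phi - theta (Suc k)\<close>. The missing part
  \<open>theta (Suc k) * q (?r k)\<close> is bounded by the square of \<open>\<beta> (Suc k)\<close>
  and the other decrement term, so the size of \<open>theta\<close> does no harm.\<close>

lemma z_minus_zbar_tendsto_0:
  assumes s: "sol s"
  shows "(\<lambda>n. z n - zbar n) \<longlonglongrightarrow> 0"
proof -
  define d where "d k = energy s k - energy s (Suc k)" for k
  let ?r = "\<lambda>k. z (Suc (Suc k)) - zbar (Suc k)"
  have qn: "q v \<ge> 0" for v by (simp add: W)
  have bound: "q (?r k) \<le> 3 * d k + 2 * (\<beta> (Suc k))\<^sup>2" if "k > 0" for k
  proof -
    let ?u = "z (Suc k) - zbar (Suc k)" and ?th = "theta (Suc k)"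
    have th: "?th > 0" using theta_pos by simp
    have "q (?r k) \<le> (1 + 1 / phi) * q (?r k)"
      using mult_right_mono[of 1 "1 + 1 / phi" "q (?r k)"] phi_gt_1 qn by simp
    moreover have "?th * q (?r k) \<le> ?th * (2 * q (z (Suc (Suc k)) - z (Suc k)) + 2 * q ?u)"
    proof (rule mult_left_mono)
      show "q (?r k) \<le> 2 * q (z (Suc (Suc k)) - z (Suc k)) + 2 * q ?u"
        using inner_wrt_diff_self_le[OF W, of "z (Suc (Suc k)) - z (Suc k)" "- ?u"]
        by (simp add: inner_wrt_diff_self_commute[OF W, of "zbar (Suc k)"])
    qed (use th in simp)
    moreover have "?th * (2 * q (z (Suc (Suc k)) - z (Suc k)) + 2 * q ?u) = 2 * (\<beta> (Suc k))\<^sup>2 + 2 * (?th * q ?u)"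
      unfolding \<beta>_square by (simp add: algebra_simps)
    moreover have "?th * q ?u + (1 + 1 / phi - ?th) * q (?r k) \<le> d k"
      using energy_Suc[OF s that] zero_le_power2[of "\<beta> (Suc k) - \<beta> k"] unfolding d_def by linarith
    moreover have "(1 + 1 / phi - ?th) * q (?r k) = (1 + 1 / phi) * q (?r k) - ?th * q (?r k)"
      by (simp add: left_diff_distrib)
    moreover have "?th * q ?u \<ge> 0" using th qn by simp
    moreover have "(1 + 1 / phi - ?th) * q (?r k) \<ge> 0" using theta_le[of k] qn by simp
    ultimately show ?thesis by linarith
  qed
  have "(\<lambda>k. 3 * d k + 2 * (\<beta> (Suc k))\<^sup>2) \<longlonglongrightarrow> 3 * 0 + 2 * 0"
    unfolding d_def by (intro tendsto_intros energy_decrement_tendsto_0 s LIMSEQ_Suc[OF \<beta>_tendsto_0[OF s]])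
  then have lim: "(\<lambda>k. 3 * d k + 2 * (\<beta> (Suc k))\<^sup>2) \<longlonglongrightarrow> 0" by simp
  have "\<forall>\<^sub>F k in sequentially. q (?r k) \<le> 3 * d k + 2 * (\<beta> (Suc k))\<^sup>2"
    using eventually_gt_at_top[of 0] by eventually_elim (rule bound)
  then have "(\<lambda>k. q (?r k)) \<longlonglongrightarrow> 0"
    by (intro tendsto_sandwich[OF always_eventually _ tendsto_const lim] allI qn)
  then have "(\<lambda>k. ?r k) \<longlonglongrightarrow> 0" by (rule tendsto_0_of_inner_wrt[OF W])
  then have "(\<lambda>k. (1 / phi) *\<^sub>R ?r k) \<longlonglongrightarrow> (1 / phi) *\<^sub>R 0" by (intro tendsto_intros)
  moreover have "(1 / phi) *\<^sub>R ?r k = z (Suc (Suc k)) - zbar (Suc (Suc k))" for k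
    using phi_gt_1 by (simp add: z_minus_zbar)
  ultimately have "(\<lambda>k. z (Suc (Suc k)) - zbar (Suc (Suc k))) \<longlonglongrightarrow> 0" by simp
  then show ?thesis
    by (intro LIMSEQ_imp_Suc[of "\<lambda>n. z n - zbar n"] LIMSEQ_imp_Suc[of "\<lambda>n. z (Suc n) - zbar (Suc n)"])
qed

lemma zbar_diff_tendsto_0:
  assumes "sol s"
  shows "(\<lambda>n. zbar (Suc n) - zbar n) \<longlonglongrightarrow> 0"
proof -
  have "(\<lambda>n. (phi - 1) *\<^sub>R (z (Suc n) - zbar (Suc n))) \<longlonglongrightarrow> (phi - 1) *\<^sub>R 0"
    by (intro tendsto_intros LIMSEQ_Suc[OF z_minus_zbar_tendsto_0[OF assms]])
  then show ?thesis by (simp add: zbar_diff)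
qed

lemma z_bounded:
  assumes "sol s"
  shows "bounded (range z)"
proof -
  have "bounded (range (\<lambda>n. z n - zbar n))"
    using z_minus_zbar_tendsto_0[OF assms] convergent_imp_bounded by blast
  from bounded_plus_comp[OF this zbar_bounded[OF assms]] show ?thesis by simp
qed

end

section \<open>Limit points lie in the domain\<close>

text \<open>An affine basis of \<open>D\<close> together with \<open>v\<close> spans a polytope with
  the same affine hull as \<open>D\<close>, whose relative interior comes arbitrarily near
  \<open>v\<close>. As \<open>p\<close> lies in that affine hull, translating an interior point by a
  small \<open>u - p\<close> stays in the polytope.\<close>

lemma exists_relative_interior_polytope:
  fixes D :: "'a::euclidean_space set"
  assumes p: "p \<in> closure D" and v: "v \<in> D" and e: "e > 0"
  obtains y V r where "finite V" "V \<subseteq> D" "V \<noteq> {}" "dist y v < e" "r > 0"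
    "\<And>u. u \<in> D \<Longrightarrow> norm (u - p) < r \<Longrightarrow> y + (u - p) \<in> convex hull V"
proof -
  obtain B where B: "B \<subseteq> D" "\<not> affine_dependent B" "affine hull D = affine hull B"
    using affine_basis_exists by blast
  define V where "V = insert v B"
  define S where "S = convex hull V"
  have V: "finite V" "V \<subseteq> D" "V \<noteq> {}"
    using B v aff_independent_finite[OF B(2)] by (auto simp: V_def)
  have "affine hull S = affine hull V" by (simp add: S_def)
  also have "\<dots> = affine hull D"
    using hull_mono[of V D affine] hull_mono[of B V affine] V(2) B(3) by (auto simp: V_def)
  finally have aff: "affine hull S = affine hull D" .
  have convS: "convex S" by (simp add: S_def)
  have "S \<noteq> {}" using V(3) by (simp add: S_def)
  then obtain c where c: "c \<in> rel_interior S" using rel_interior_eq_empty[OF convS] by auto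
  define d where "d = norm (v - c) + 1"
  have d: "d > 0" by (simp add: d_def add_nonneg_pos)
  define t where "t = min 1 (e / (2 * d))"
  have t: "t > 0" "t \<le> 1" using e d by (auto simp: t_def)
  define y where "y = v - t *\<^sub>R (v - c)"
  have "y \<in> rel_interior S" unfolding y_def
    by (intro rel_interior_convex_shrink convS c t) (auto simp: S_def V_def hull_inc)
  then obtain r where r: "y \<in> S" "r > 0" "cball y r \<inter> affine hull S \<subseteq> S"
    using mem_rel_interior_cball by blast
  have "dist y v = t * norm (v - c)" using t by (simp add: y_def dist_norm)
  also have "\<dots> \<le> t * d" using t by (simp add: d_def)
  also have "\<dots> \<le> e / (2 * d) * d"
    using d by (intro mult_right_mono) (auto simp: t_def)
  also have "\<dots> = e / 2" using d by simp
  also have "\<dots> < e" using e by simp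
  finally have "dist y v < e" .
  moreover have "y + (u - p) \<in> convex hull V" if u: "u \<in> D" "norm (u - p) < r" for u
  proof -
    have "y + 1 *\<^sub>R (u - p) \<in> affine hull S"
    proof (intro mem_affine_3_minus affine_affine_hull)
      show "y \<in> affine hull S" using r(1) by (rule hull_inc)
      show "u \<in> affine hull S" using u(1) aff by (simp add: hull_inc)
      show "p \<in> affine hull S" using p closure_affine_hull aff by blast
    qed
    moreover have "y + (u - p) \<in> cball y r" using u(2) by (simp add: dist_norm norm_minus_commute)
    ultimately show ?thesis using r(3) by (auto simp: S_def)
  qed
  ultimately show thesis using that V r(2) by blast
qed

text \<open>The time parameter of \<open>local_lipschitz\<close> is inert here; halving the radius
  replaces open balls by closed ones.\<close>

lemma local_lipschitz_of_locally_lipschitz_on: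
  assumes "locally_lipschitz_on D h"
  shows "local_lipschitz T D (\<lambda>_. h)"
proof (rule local_lipschitzI)
  fix t x assume "x \<in> D"
  then obtain r L where r: "r > 0" "L-lipschitz_on (ball x r \<inter> D) h"
    using assms unfolding locally_lipschitz_on_def by blast
  have "cball x (r / 2) \<inter> D \<subseteq> ball x r \<inter> D" using r(1) by auto
  then have "L-lipschitz_on (cball x (r / 2) \<inter> D) h" using r(2) lipschitz_on_subset by blast
  then show "\<exists>u>0. \<exists>L. \<forall>t\<in>cball t u \<inter> T. L-lipschitz_on (cball x u \<inter> D) h"
    using r(1) by (intro exI[of _ "r / 2"]) auto
qed

lemma continuous_on_of_locally_lipschitz_on:
  assumes "locally_lipschitz_on D h"
  shows "continuous_on D h"
  by (rule local_lipschitz_continuous_on[OF local_lipschitz_of_locally_lipschitz_on[OF assms],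
        of "0::real" "{0}"]) simp

context golden_ratio_iteration
begin

text \<open>Writing \<open>y - p = (y + (u - p)) - u\<close> with \<open>y + (u - p)\<close> in the polytope, monotonicity bounds
  \<open>\<langle>A u, y - p\<rangle>\<close> near \<open>p\<close> although \<^term>\<open>A\<close> itself may blow up there, and the subgradient inequality
  bounds the other part of the step by a constant minus \<^term>\<open>f\<close>, which tends to infinity.\<close>
lemma increment_nonneg_near:
  assumes p: "p \<notin> D" and V: "finite V" "V \<subseteq> D" "V \<noteq> {}" and r: "r > 0"
    and y: "\<And>u. u \<in> D \<Longrightarrow> norm (u - p) < r \<Longrightarrow> y + (u - p) \<in> convex hull V"
  shows "\<exists>\<delta>>0. \<forall>k. norm (z (Suc k) - p) < \<delta> \<longrightarrow> norm (z (Suc (Suc k)) - p) < \<delta> \<longrightarrow>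
           0 \<le> inner_wrt W (zbar (Suc (Suc k)) - zbar (Suc k)) (y - p)"
proof -
  \<comment> \<open>For \<open>u\<close> within \<open>r\<close> of \<open>p\<close> the bracket
    bounds \<open>norm (v - u)\<close>, so \<open>C1\<close> bounds
    \<open>inner_wrt W (A v) (v - u)\<close> uniformly in \<open>u\<close>.\<close>
  define C1 where "C1 = Max ((\<lambda>v. norm (W (A v)) * (norm (v - p) + r)) ` V)"
  define C2 where "C2 = Max (f ` V)"
  \<comment> \<open>A bound for a linear functional at the vertices holds on the convex hull, since
    half-spaces are convex.\<close>
  have hull: "inner_wrt W a (x - u) \<le> C" if "\<And>v. v \<in> V \<Longrightarrow> inner_wrt W a (v - u) \<le> C" "x \<in> convex hull V"
    for a u x C
  proof -
    have "convex hull V \<subseteq> {x. W a \<bullet> x \<le> C + W a \<bullet> u}"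
      by (rule hull_minimal)
        (use that(1) in \<open>auto simp: convex_halfspace_le inner_wrt_def inner_diff_right algebra_simps\<close>)
    with that(2) show ?thesis by (auto simp: inner_wrt_def inner_diff_right)
  qed
  have A_bound: "inner_wrt W (A u) (y - p) \<le> C1" if u: "u \<in> D" "norm (u - p) < r" for u
  proof -
    have "inner_wrt W (A u) ((y + (u - p)) - u) \<le> C1"
    proof (rule hull)
      fix v assume v: "v \<in> V"
      have "0 \<le> inner_wrt W (A v - A u) (v - u)" using A_mono[of v u] v V(2) u by blast
      then have "inner_wrt W (A u) (v - u) \<le> inner_wrt W (A v) (v - u)"
        by (simp add: inner_wrt_diff_left[OF W])
      also have "\<dots> \<le> norm (W (A v)) * norm (v - u)"
        unfolding inner_wrt_def by (rule norm_cauchy_schwarz)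
      also have "\<dots> \<le> norm (W (A v)) * (norm (v - p) + r)"
        using u(2) norm_triangle_ineq[of "v - p" "p - u"]
        by (intro mult_left_mono) (auto simp: norm_minus_commute[of p])
      also have "\<dots> \<le> C1" unfolding C1_def using V(1) v by simp
      finally show "inner_wrt W (A u) (v - u) \<le> C1" .
    qed (rule y[OF u])
    then show ?thesis by simp
  qed
  \<comment> \<open>The threshold makes \<open>l * (C2 - f x)\<close> at most
    \<open>- l * C1\<close>, which cancels the contribution of \<open>A\<close>; both scale with
    \<open>l\<close>, so no bound on the step size enters.\<close>
  obtain \<delta>0 where \<delta>0: "\<delta>0 > 0" "\<And>u. u \<in> D \<Longrightarrow> norm (u - p) < \<delta>0 \<Longrightarrow> f u > C1 + C2"
    using large_near[OF p] by metis
  have "0 \<le> inner_wrt W (zbar (Suc (Suc k)) - zbar (Suc k)) (y - p)"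
    if k: "norm (z (Suc k) - p) < min r \<delta>0" "norm (z (Suc (Suc k)) - p) < min r \<delta>0" for k
  proof -
    define l a x where "l = lam (Suc k)" and "a = A (z (Suc k))" and "x = z (Suc (Suc k))"
    have l: "l > 0" by (simp add: l_def lam_pos)
    have "f x > C1 + C2" unfolding x_def using k(2) by (intro \<delta>0 z_in_D) simp
    have "inner_wrt W (zbar (Suc k) - l *\<^sub>R a - x) ((y + (x - p)) - x) \<le> l * (C2 - f x)"
    proof (rule hull)
      fix v assume v: "v \<in> V"
      have "inner_wrt W (zbar (Suc k) - l *\<^sub>R a - x) (v - x) \<le> l * (f v - f x)"
        unfolding l_def a_def x_def using v V(2) by (intro prox_step) auto
      also have "\<dots> \<le> l * (C2 - f x)"
        using l V(1) v by (intro mult_left_mono) (auto simp: C2_def)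
      finally show "inner_wrt W (zbar (Suc k) - l *\<^sub>R a - x) (v - x) \<le> l * (C2 - f x)" .
    next
      show "y + (x - p) \<in> convex hull V" unfolding x_def using k(2) by (intro y z_in_D) simp
    qed
    also have "\<dots> \<le> l * (- C1)" using l \<open>f x > C1 + C2\<close> by (intro mult_left_mono) auto
    finally have "inner_wrt W (zbar (Suc k) - l *\<^sub>R a - x) (y - p) \<le> - (l * C1)" by simp
    moreover have "inner_wrt W a (y - p) \<le> C1"
      unfolding a_def using k(1) by (intro A_bound z_in_D) simp
    then have "l * inner_wrt W a (y - p) \<le> l * C1" using l by (intro mult_left_mono) auto
    moreover have "inner_wrt W (zbar (Suc k) - l *\<^sub>R a - x) (y - p)
        = inner_wrt W (zbar (Suc k) - x) (y - p) - l * inner_wrt W a (y - p)"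
      by (simp add: inner_wrt_diff_left[OF W] inner_wrt_scaleR_left[OF W])
    ultimately have "inner_wrt W (zbar (Suc k) - x) (y - p) \<le> 0" by linarith
    then have "0 \<le> inner_wrt W (x - zbar (Suc k)) (y - p)"
      by (simp add: inner_wrt_diff_left[OF W])
    then show ?thesis
      unfolding zbar_diff' inner_wrt_scaleR_left[OF W] x_def using phi_gt_1 by simp
  qed
  then show ?thesis using r \<delta>0(1) by (intro exI[of _ "min r \<delta>0"]) simp
qed

text \<open>Unit directions from \<open>p\<close> into \<^term>\<open>D\<close> form a relatively compact set, so finitely many points
  \<open>y\<close> of the previous lemma see all of them at an acute angle. Hence the largest \<open>\<langle>zbar - p, y - p\<rangle>\<close> is
  comparable to the distance to \<open>p\<close>, and it cannot decrease near \<open>p\<close>.\<close>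
lemma finite_test_points:
  assumes p: "p \<notin> D" "p \<in> closure D"
  obtains Y r \<eta> where "finite Y" "r > 0" "\<eta> > 0"
    "\<And>x. x \<in> D \<Longrightarrow> \<exists>y\<in>Y. inner_wrt W (x - p) (y - p) \<ge> \<eta> * norm (x - p)"
    "\<And>y k. y \<in> Y \<Longrightarrow> norm (z (Suc k) - p) < r \<Longrightarrow> norm (z (Suc (Suc k)) - p) < r \<Longrightarrow>
       0 \<le> inner_wrt W (zbar (Suc (Suc k)) - zbar (Suc k)) (y - p)"
proof -
  define dir where "dir x = (1 / norm (x - p)) *\<^sub>R (x - p)" for x
  define T where "T = closure (dir ` D)"
  define good where "good y \<delta> \<longleftrightarrow> \<delta> > 0 \<and> (\<forall>k. norm (z (Suc k) - p) < \<delta> \<longrightarrow>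
      norm (z (Suc (Suc k)) - p) < \<delta> \<longrightarrow>
      0 \<le> inner_wrt W (zbar (Suc (Suc k)) - zbar (Suc k)) (y - p))" for y \<delta>
  \<comment> \<open>An index records a test point, a lower bound for its inner product with
    directions, and a radius within which the increments are controlled.\<close>
  define Idx where "Idx = {(y, e::real, \<delta>). e > 0 \<and> good y \<delta>}"
  define U where "U = (\<lambda>(y, e, \<delta>::real). {d. e < inner_wrt W d (y - p)})"
  have ne: "x - p \<noteq> 0" if "x \<in> D" for x using that p(1) by auto
  have norm_dir: "norm (dir x) = 1" if "x \<in> D" for x
    using ne[OF that] by (simp add: dir_def)
  have "dir ` D \<subseteq> sphere 0 1" using norm_dir by auto
  then have T_sphere: "T \<subseteq> sphere 0 1" unfolding T_def by (intro closure_minimal) auto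
  then have "compact T"
    unfolding T_def compact_eq_bounded_closed using bounded_sphere bounded_subset by blast
  moreover have "open (U i)" for i
  proof -
    have "U i = {d. fst (snd i) < inner_wrt W d (fst i - p)}" by (simp add: U_def split: prod.splits)
    then show ?thesis by (simp, intro open_Collect_less continuous_intros W)
  qed
  moreover have "T \<subseteq> (\<Union>i\<in>Idx. U i)"
  proof
    fix d assume d: "d \<in> T"
    then have "d \<noteq> 0" using T_sphere by auto
    then have "open {x. 0 < inner_wrt W d x}" "d \<in> {x. 0 < inner_wrt W d x}"
      by (auto intro!: open_Collect_less continuous_intros W inner_wrt_pos[OF W])
    \<comment> \<open>A limit direction \<open>d\<close> is nearly attained at some \<open>x\<close>
      in \<open>D\<close>; moving \<open>x\<close> slightly to a relative interior point
      \<open>y\<close> of a polytope keeps the inner product with \<open>d\<close> positive.\<close>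
    then have "\<exists>x\<in>D. 0 < inner_wrt W d (dir x)"
      using d open_Int_closure_eq_empty[of "{x. 0 < inner_wrt W d x}" "dir ` D"] unfolding T_def by blast
    then obtain x where x: "x \<in> D" "0 < inner_wrt W d (dir x)" by blast
    have "0 < inner_wrt W d (x - p)"
      using x(2) ne[OF x(1)] by (simp add: dir_def inner_wrt_scaleR_right[OF W] zero_less_divide_iff)
    then have "open {y. 0 < inner_wrt W d (y - p)}" "x \<in> {y. 0 < inner_wrt W d (y - p)}"
      by (auto intro!: open_Collect_less continuous_intros W)
    then obtain e where e: "e > 0" "\<And>y. dist y x < e \<Longrightarrow> 0 < inner_wrt W d (y - p)"
      unfolding open_dist by blast
    obtain y V r where y: "finite V" "V \<subseteq> D" "V \<noteq> {}" "dist y x < e" "r > 0"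
      "\<And>u. u \<in> D \<Longrightarrow> norm (u - p) < r \<Longrightarrow> y + (u - p) \<in> convex hull V"
      using exists_relative_interior_polytope[OF p(2) x(1) e(1)] by metis
    obtain \<delta> where "good y \<delta>"
      using increment_nonneg_near[OF p(1) y(1,2,3,5,6)] unfolding good_def by blast
    then have "(y, inner_wrt W d (y - p) / 2, \<delta>) \<in> Idx"
      using e(2)[OF y(4)] by (simp add: Idx_def)
    moreover have "d \<in> U (y, inner_wrt W d (y - p) / 2, \<delta>)"
      using e(2)[OF y(4)] by (simp add: U_def)
    ultimately show "d \<in> (\<Union>i\<in>Idx. U i)" by blast
  qed
  ultimately obtain J where J: "J \<subseteq> Idx" "finite J" "T \<subseteq> (\<Union>i\<in>J. U i)"
    by (metis compactE_image)
  have dirT: "dir x \<in> T" if "x \<in> D" for x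
    unfolding T_def by (rule subsetD[OF closure_subset]) (use that in simp)
  have "J \<noteq> {}" using nonempty dirT J(3) by auto
  define r where "r = Min ((\<lambda>i. snd (snd i)) ` J)"
  define \<eta> where "\<eta> = Min ((\<lambda>i. fst (snd i)) ` J)"
  have "r > 0" unfolding r_def using J \<open>J \<noteq> {}\<close> by (subst Min_gr_iff) (auto simp: Idx_def good_def)
  moreover have "\<eta> > 0" unfolding \<eta>_def using J \<open>J \<noteq> {}\<close> by (subst Min_gr_iff) (auto simp: Idx_def)
  moreover have "\<exists>y\<in>fst ` J. inner_wrt W (x - p) (y - p) \<ge> \<eta> * norm (x - p)" if x: "x \<in> D" for x
  proof -
    obtain i where i: "i \<in> J" "dir x \<in> U i" using dirT[OF x] J(3) by blast
    have "\<eta> \<le> fst (snd i)" unfolding \<eta>_def using J(2) i(1) by (intro Min_le) auto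
    also have "fst (snd i) \<le> inner_wrt W (dir x) (fst i - p)"
      using i(2) by (auto simp: U_def split: prod.splits)
    also have "\<dots> = inner_wrt W (x - p) (fst i - p) / norm (x - p)"
      by (simp add: dir_def inner_wrt_scaleR_left[OF W])
    finally have "\<eta> * norm (x - p) \<le> inner_wrt W (x - p) (fst i - p)"
      using ne[OF x] by (simp add: pos_le_divide_eq)
    then show ?thesis using i(1) by blast
  qed
  moreover have "0 \<le> inner_wrt W (zbar (Suc (Suc k)) - zbar (Suc k)) (y - p)"
    if y: "y \<in> fst ` J" and k: "norm (z (Suc k) - p) < r" "norm (z (Suc (Suc k)) - p) < r" for y k
  proof -
    obtain e \<delta> where i: "(y, e, \<delta>) \<in> J" using y by auto
    then have "good y \<delta>" using J(1) by (auto simp: Idx_def)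
    moreover have "r \<le> \<delta>" unfolding r_def using J(2) i by (intro Min_le) force+
    ultimately show ?thesis using k unfolding good_def by (meson order_less_le_trans)
  qed
  ultimately show thesis using that[of "fst ` J" r \<eta>] J(2) by blast
qed

text \<open>Invariant: some test point \<open>y\<close> satisfies
  \<open>\<mu> \<le> inner_wrt W (zbar (Suc k) - p) (y - p)\<close>. Near \<open>p\<close> the same
  \<open>y\<close> survives because the increment is nonnegative; farther out \<open>far\<close>
  supplies a fresh one. Cauchy-Schwarz turns the invariant into a distance.\<close>

lemma zbar_eventually_away:
  assumes s: "sol s" and p: "p \<notin> D" "p \<in> closure D"
  obtains \<delta> K where "\<delta> > 0" "\<And>k. k \<ge> K \<Longrightarrow> \<delta> \<le> norm (zbar k - p)"
proof -
  obtain Y r \<eta> where Y: "finite Y" "r > 0" "\<eta> > 0"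
    and far: "\<And>x. x \<in> D \<Longrightarrow> \<exists>y\<in>Y. inner_wrt W (x - p) (y - p) \<ge> \<eta> * norm (x - p)"
    and incr: "\<And>y k. y \<in> Y \<Longrightarrow> norm (z (Suc k) - p) < r \<Longrightarrow> norm (z (Suc (Suc k)) - p) < r \<Longrightarrow>
       0 \<le> inner_wrt W (zbar (Suc (Suc k)) - zbar (Suc k)) (y - p)"
    using finite_test_points[OF p] by blast
  have "\<forall>\<^sub>F k in sequentially. norm (z k - zbar k) < r / 4 \<and> norm (zbar (Suc k) - zbar k) < r / 4"
    using tendstoD[OF z_minus_zbar_tendsto_0[OF s], of "r / 4"]
      tendstoD[OF zbar_diff_tendsto_0[OF s], of "r / 4"] Y(2) by (simp add: eventually_conj)
  then obtain K where K: "\<And>k. k \<ge> K \<Longrightarrow> norm (z k - zbar k) < r / 4"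
      "\<And>k. k \<ge> K \<Longrightarrow> norm (zbar (Suc k) - zbar k) < r / 4"
    unfolding eventually_sequentially by blast
  \<comment> \<open>The first entry starts the induction; the second is what \<open>far\<close>
    guarantees after a step from distance at least \<open>r / 2\<close>, which ends at distance at
    least \<open>r / 4\<close>.\<close>
  define \<mu> where "\<mu> = min (\<eta> * norm (zbar (Suc K) - p)) (\<eta> * (r / 4))"
  have "zbar (Suc K) \<noteq> p" using zbar_in_D p(1) by metis
  then have \<mu>: "\<mu> > 0" using Y by (simp add: \<mu>_def)
  have inv: "\<exists>y\<in>Y. \<mu> \<le> inner_wrt W (zbar (Suc k) - p) (y - p)" if "k \<ge> K" for k
    using that
  proof (induction rule: dec_induct)
    case base
    obtain y where "y \<in> Y" "inner_wrt W (zbar (Suc K) - p) (y - p) \<ge> \<eta> * norm (zbar (Suc K) - p)"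
      using far[OF zbar_in_D] by blast
    then show ?case by (intro bexI[of _ y]) (auto simp: \<mu>_def)
  next
    case (step k)
    have k: "norm (z (Suc k) - zbar (Suc k)) < r / 4" "norm (z (Suc (Suc k)) - zbar (Suc (Suc k))) < r / 4"
      "norm (zbar (Suc (Suc k)) - zbar (Suc k)) < r / 4"
      using K step.hyps by simp_all
    show ?case
    proof (cases "norm (zbar (Suc k) - p) < r / 2")
      case True
      obtain y where y: "y \<in> Y" "\<mu> \<le> inner_wrt W (zbar (Suc k) - p) (y - p)" using step.IH by blast
      have "norm (z (Suc k) - p) < r"
        using norm_triangle_ineq[of "z (Suc k) - zbar (Suc k)" "zbar (Suc k) - p"] k True Y(2) by simp
      moreover have "norm (zbar (Suc (Suc k)) - p) < 3 * r / 4"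
        using norm_triangle_ineq[of "zbar (Suc (Suc k)) - zbar (Suc k)" "zbar (Suc k) - p"] k True Y(2) by simp
      then have "norm (z (Suc (Suc k)) - p) < r"
        using norm_triangle_ineq[of "z (Suc (Suc k)) - zbar (Suc (Suc k))" "zbar (Suc (Suc k)) - p"] k Y(2) by simp
      ultimately have "0 \<le> inner_wrt W (zbar (Suc (Suc k)) - zbar (Suc k)) (y - p)"
        by (rule incr[OF y(1)])
      then have "\<mu> \<le> inner_wrt W (zbar (Suc (Suc k)) - p) (y - p)"
        using y(2) by (simp add: inner_wrt_diff_left[OF W])
      with y(1) show ?thesis by blast
    next
      case False
      have "r / 4 \<le> norm (zbar (Suc (Suc k)) - p)"
        using norm_triangle_ineq[of "zbar (Suc k) - zbar (Suc (Suc k))" "zbar (Suc (Suc k)) - p"] k(3) False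
        by (simp add: norm_minus_commute[of "zbar (Suc k)"])
      then have "\<eta> * (r / 4) \<le> \<eta> * norm (zbar (Suc (Suc k)) - p)" using Y by (intro mult_left_mono) auto
      moreover obtain y where "y \<in> Y"
          "inner_wrt W (zbar (Suc (Suc k)) - p) (y - p) \<ge> \<eta> * norm (zbar (Suc (Suc k)) - p)"
        using far[OF zbar_in_D] by blast
      ultimately show ?thesis by (intro bexI[of _ y]) (auto simp: \<mu>_def)
    qed
  qed
  define B where "B = (\<Sum>y\<in>Y. norm (W (y - p))) + 1"
  have B: "B > 0" by (simp add: B_def sum_nonneg add_nonneg_pos)
  have "\<mu> / B \<le> norm (zbar k - p)" if k: "k \<ge> Suc K" for k
  proof -
    obtain j where j: "k = Suc j" "j \<ge> K" using k by (cases k) auto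
    obtain y where y: "y \<in> Y" "\<mu> \<le> inner_wrt W (zbar k - p) (y - p)" using inv[OF j(2)] j(1) by blast
    note y(2)
    also have "inner_wrt W (zbar k - p) (y - p) = W (y - p) \<bullet> (zbar k - p)"
      unfolding inner_wrt_commute[OF W, of "zbar k - p"] by (simp add: inner_wrt_def)
    also have "\<dots> \<le> norm (W (y - p)) * norm (zbar k - p)" by (rule norm_cauchy_schwarz)
    also have "\<dots> \<le> B * norm (zbar k - p)"
      using member_le_sum[of y Y "\<lambda>y. norm (W (y - p))"] y(1) Y(1)
      by (intro mult_right_mono) (auto simp: B_def)
    finally show ?thesis using B by (simp add: field_simps)
  qed
  moreover have "\<mu> / B > 0" using \<mu> B by simp
  ultimately show thesis using that by blast
qed

lemma closure_range_z_subset: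
  assumes s: "sol s"
  shows "closure (range z) \<subseteq> D"
proof (rule ccontr)
  assume "\<not> ?thesis"
  then obtain p where p: "p \<in> closure (range z)" "p \<notin> D" by blast
  have "range z \<subseteq> D" using z_in_D by blast
  then have "p \<in> closure D" using p(1) closure_mono by blast
  then obtain \<delta> K where \<delta>: "\<delta> > 0" "\<And>k. k \<ge> K \<Longrightarrow> \<delta> \<le> norm (zbar k - p)"
    using zbar_eventually_away[OF s p(2)] by blast
  obtain N where N: "\<And>k. k \<ge> N \<Longrightarrow> norm (z k - zbar k) < \<delta> / 2"
    using tendstoD[OF z_minus_zbar_tendsto_0[OF s], of "\<delta> / 2"] \<delta>(1)
    unfolding eventually_sequentially by auto
  let ?N = "max K N"
  have away: "\<delta> / 2 \<le> dist (z k) p" if "k \<ge> ?N" for k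
    using that \<delta>(2)[of k] N[of k] norm_triangle_ineq[of "zbar k - z k" "z k - p"]
    by (simp add: dist_norm norm_minus_commute[of "zbar k"])
  \<comment> \<open>This closed set consists of finitely many points of \<open>D\<close> and the
    complement of a ball about \<open>p\<close>, so it cannot contain \<open>p\<close>.\<close>
  have "range z \<subseteq> z ` {..<?N} \<union> - ball p (\<delta> / 2)"
  proof
    fix x assume "x \<in> range z"
    then obtain k where "x = z k" by blast
    with away[of k] show "x \<in> z ` {..<?N} \<union> - ball p (\<delta> / 2)"
      by (cases "?N \<le> k") (auto simp: dist_commute simp del: max.bounded_iff)
  qed
  moreover have "closed (z ` {..<?N} \<union> - ball p (\<delta> / 2))"
    by (intro closed_Un finite_imp_closed finite_imageI finite_lessThan closed_Compl open_ball)
  ultimately have "p \<in> z ` {..<?N} \<union> - ball p (\<delta> / 2)"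
    using p(1) closure_minimal[of "range z"] by blast
  then show False using p(2) z_in_D \<delta>(1) by auto
qed

text \<open>The orbit closure is a compact subset of \<open>D\<close>, so the local constants merge
  into one.\<close>

lemma A_lipschitz_on_orbit:
  assumes s: "sol s" and A: "locally_lipschitz_on D A"
  obtains L where "L-lipschitz_on (range z) A"
proof -
  have "local_lipschitz {0::real} D (\<lambda>_. A)"
    by (rule local_lipschitz_of_locally_lipschitz_on[OF A])
  then have "local_lipschitz {0::real} (closure (range z)) (\<lambda>_. A)"
    using closure_range_z_subset[OF s] by (rule local_lipschitz_subset[OF _ order_refl])
  moreover have "compact (closure (range z))" using z_bounded[OF s] by (simp add: compact_closure)
  ultimately obtain L where "\<And>t. t \<in> {0::real} \<Longrightarrow> L-lipschitz_on (closure (range z)) A"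
    by (rule local_lipschitz_compact_implies_lipschitz) auto
  then have "L-lipschitz_on (closure (range z)) A" by blast
  then show thesis using that lipschitz_on_subset closure_subset by blast
qed

section \<open>Convergence\<close>

text \<open>Successive \<open>z\<close> and \<open>zbar\<close> share the limit \<open>p\<close>.
  After division of the prox inequality by the step size, the bound \<open>m\<close> makes the
  displacement term vanish, while the closed epigraph handles \<open>f\<close>, which need not be
  continuous.\<close>

lemma limit_point_is_solution:
  assumes s: "sol s" and A: "continuous_on D A" and lam: "m > 0" "\<And>k. lam (Suc k) \<ge> m"
    and r: "strict_mono r" "(\<lambda>n. z (Suc (r n))) \<longlonglongrightarrow> p"
  shows "sol p"
proof -
  have subseq: "(\<lambda>n. X (r n)) \<longlonglongrightarrow> l" if "X \<longlonglongrightarrow> l" for X :: "nat \<Rightarrow> 'a" and l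
    using LIMSEQ_subseq_LIMSEQ[OF that r(1)] by (simp add: comp_def)
  have "p \<in> closure (range z)" by (rule closed_sequentially[OF closed_closure _ r(2)]) (simp add: subsetD[OF closure_subset])
  then have pD: "p \<in> D" using closure_range_z_subset[OF s] by blast
  have zb: "(\<lambda>n. zbar (Suc (r n))) \<longlonglongrightarrow> p"
    using tendsto_diff[OF r(2) subseq[OF LIMSEQ_Suc[OF z_minus_zbar_tendsto_0[OF s]]]] by simp
  have zb2: "(\<lambda>n. zbar (Suc (Suc (r n)))) \<longlonglongrightarrow> p"
    using tendsto_add[OF zb subseq[OF LIMSEQ_Suc[OF zbar_diff_tendsto_0[OF s]]]] by simp
  have z2: "(\<lambda>n. z (Suc (Suc (r n)))) \<longlonglongrightarrow> p"
    using tendsto_add[OF subseq[OF LIMSEQ_Suc[OF LIMSEQ_Suc[OF z_minus_zbar_tendsto_0[OF s]]]] zb2] by simp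
  have Az: "(\<lambda>n. A (z (Suc (r n)))) \<longlonglongrightarrow> A p"
    using continuous_on_tendsto_compose[OF A r(2) pD] z_in_D by simp
  have "f p \<le> f v + inner_wrt W (A p) (v - p)" if v: "v \<in> D" for v
  proof -
    define x a g where "x n = z (Suc (Suc (r n)))" and "a n = A (z (Suc (r n)))"
      and "g n = inner_wrt W (zbar (Suc (r n)) - x n) (v - x n)" for n
    have bound: "f (x n) \<le> f v + \<bar>g n\<bar> / m + inner_wrt W (a n) (v - x n)" for n
    proof -
      let ?l = "lam (Suc (r n))"
      have l: "?l > 0" by (rule lam_pos)
      have "g n - ?l * inner_wrt W (a n) (v - x n) \<le> ?l * (f v - f (x n))"
        using prox_step[OF v, of "r n"]
        by (simp add: g_def a_def x_def inner_wrt_diff_left[OF W] inner_wrt_scaleR_left[OF W])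
      then have "?l * f (x n) \<le> ?l * (f v + - g n / ?l + inner_wrt W (a n) (v - x n))"
        using l by (simp add: algebra_simps)
      then have "f (x n) \<le> f v + - g n / ?l + inner_wrt W (a n) (v - x n)" using l by simp
      moreover have "- g n / ?l \<le> \<bar>g n\<bar> / m"
        using l lam by (intro frac_le) auto
      ultimately show ?thesis by linarith
    qed
    have "g \<longlonglongrightarrow> inner_wrt W (p - p) (v - p)"
      unfolding g_def x_def by (intro tendsto_inner_wrt[OF W] tendsto_diff zb z2 tendsto_const)
    then have "g \<longlonglongrightarrow> 0" by (simp add: W)
    then have "(\<lambda>n. f v + \<bar>g n\<bar> / m + inner_wrt W (a n) (v - x n)) \<longlonglongrightarrow> f v + \<bar>0\<bar> / m + inner_wrt W (A p) (v - p)"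
      unfolding a_def x_def using lam(1)
      by (intro tendsto_add tendsto_divide tendsto_rabs tendsto_inner_wrt[OF W] tendsto_diff Az z2 tendsto_const) auto
    then have lim: "(\<lambda>n. f v + \<bar>g n\<bar> / m + inner_wrt W (a n) (v - x n)) \<longlonglongrightarrow> f v + inner_wrt W (A p) (v - p)"
      by simp
    show ?thesis
      using closed_epigraph_limit[OF _ z2[folded x_def] bound lim] z_in_D by (simp add: x_def)
  qed
  then show ?thesis using pD by (auto simp: sol_def algebra_simps)
qed

text \<open>For positive \<open>k\<close> in the quotient case,
  \<open>theta k = phi * lam k / lam (k - 1)\<close> cancels \<open>lam k\<close> and leaves the
  factor \<open>phi\<^sup>2 / (4 * lam (k - 1))\<close>, bounded below because step sizes are
  bounded above; the Lipschitz constant bounds the quotient. A fixed \<open>m\<close> is thus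
  preserved by induction.\<close>

lemma lam_bounded_below:
  assumes s: "sol s" and A: "locally_lipschitz_on D A"
    and b: "b > 0" "\<And>k. lam (Suc k) \<le> b"
    and cases: "\<And>k. lam (Suc k) \<ge> lam k \<or> lam (Suc k) = b \<or>
       q (A (z (Suc k)) - A (z k)) \<noteq> 0 \<and> lam (Suc k) = phi * theta k / (4 * lam k) *
         (q (z (Suc k) - z k) / q (A (z (Suc k)) - A (z k)))"
  obtains m where "m > 0" "\<And>k. lam (Suc k) \<ge> m"
proof -
  obtain L where L: "L-lipschitz_on (range z) A" using A_lipschitz_on_orbit[OF s A] .
  obtain a where a: "a > 0" "\<And>x. a * (norm x)\<^sup>2 \<le> q x" using inner_wrt_lower_bound[OF W] by blast
  obtain K where K: "K > 0" "\<And>x. q x \<le> K * (norm x)\<^sup>2" using inner_wrt_upper_bound[OF W] by blast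
  \<comment> \<open>The summand 1 keeps \<open>C\<close> positive even for
    \<open>L = 0\<close>.\<close>
  define C where "C = K * L\<^sup>2 / a + 1"
  have C: "C > 0" using K(1) a(1) by (simp add: C_def add_nonneg_pos)
  have qA: "q (A (z (Suc k)) - A (z k)) \<le> C * q (z (Suc k) - z k)" for k
  proof -
    have "norm (A (z (Suc k)) - A (z k)) \<le> L * norm (z (Suc k) - z k)"
      using lipschitz_onD[OF L, of "z (Suc k)" "z k"] by (simp add: dist_norm)
    then have "(norm (A (z (Suc k)) - A (z k)))\<^sup>2 \<le> L\<^sup>2 * (norm (z (Suc k) - z k))\<^sup>2"
      using power_mono[of _ "L * norm (z (Suc k) - z k)" 2] by (simp add: power_mult_distrib)
    then have "K * (norm (A (z (Suc k)) - A (z k)))\<^sup>2 \<le> K * (L\<^sup>2 * (norm (z (Suc k) - z k))\<^sup>2)"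
      using K(1) by simp
    also have "\<dots> = K * L\<^sup>2 / a * (a * (norm (z (Suc k) - z k))\<^sup>2)" using a(1) by simp
    also have "\<dots> \<le> K * L\<^sup>2 / a * q (z (Suc k) - z k)"
      using a K(1) by (intro mult_left_mono) auto
    also have "\<dots> \<le> C * q (z (Suc k) - z k)"
      unfolding C_def by (intro mult_right_mono) (auto simp: W)
    finally show ?thesis using K(2) order_trans by blast
  qed
  define \<Lambda> where "\<Lambda> = max (lam 0) b"
  have \<Lambda>0: "\<Lambda> > 0" using b(1) by (simp add: \<Lambda>_def)
  have \<Lambda>: "lam k \<le> \<Lambda>" for k
    using b(2) by (cases k) (auto simp: \<Lambda>_def le_max_iff_disj)
  define m where "m = min (lam 1) (min b (phi\<^sup>2 / (4 * \<Lambda> * C)))"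
  have "m > 0" using lam_pos b(1) \<Lambda>0 C phi_gt_1 by (simp add: m_def)
  moreover have "m \<le> lam (Suc k)" for k
  proof (induction k)
    case 0
    show ?case by (simp add: m_def)
  next
    case (Suc k)
    let ?dA = "q (A (z (Suc (Suc k))) - A (z (Suc k)))" and ?dz = "q (z (Suc (Suc k)) - z (Suc k))"
    from cases[of "Suc k"] consider "lam (Suc k) \<le> lam (Suc (Suc k))" | "lam (Suc (Suc k)) = b"
      | "?dA \<noteq> 0" "lam (Suc (Suc k)) = phi * theta (Suc k) / (4 * lam (Suc k)) * (?dz / ?dA)"
      by blast
    then show ?case
    proof cases
      case 1
      with Suc show ?thesis by linarith
    next
      case 2
      then show ?thesis by (simp add: m_def)
    next
      case 3
      have "?dA > 0" using 3(1) inner_wrt_nonneg[OF W] by (simp add: order_less_le)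
      then have "1 / C \<le> ?dz / ?dA" using qA[of "Suc k"] C by (simp add: field_simps)
      moreover have "theta (Suc k) = phi * lam (Suc k) / lam k"
        using theta_Suc[of k] lam_pos[of k] by (simp add: field_simps)
      then have "phi * theta (Suc k) / (4 * lam (Suc k)) = phi\<^sup>2 / (4 * lam k)"
        using lam_pos[of "Suc k"] by (simp add: power2_eq_square)
      moreover have "phi\<^sup>2 / (4 * \<Lambda>) \<le> phi\<^sup>2 / (4 * lam k)"
        using \<Lambda>[of k] lam_pos[of k] \<Lambda>0 by (intro divide_left_mono) auto
      ultimately have "phi\<^sup>2 / (4 * \<Lambda>) * (1 / C) \<le> lam (Suc (Suc k))"
        unfolding 3(2) using C lam_pos[of k] by (intro mult_mono) auto
      then show ?thesis by (simp add: m_def min_le_iff_disj)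
    qed
  qed
  ultimately show thesis by (rule that)
qed

text \<open>The energy relative to a limit point \<open>p\<close> converges because \<open>p\<close>
  is itself a solution, and along the subsequence it tends to zero; hence all of it does.\<close>

lemma converges_to_solution:
  assumes s: "sol s" and A: "continuous_on D A" and lam: "m > 0" "\<And>k. lam (Suc k) \<ge> m"
  shows "\<exists>p. sol p \<and> z \<longlonglongrightarrow> p \<and> zbar \<longlonglongrightarrow> p"
proof -
  have "bounded (range (\<lambda>n. z (Suc n)))" using z_bounded[OF s] by (rule bounded_subset) auto
  then obtain p r where r1: "strict_mono r" and "((\<lambda>n. z (Suc n)) \<circ> r) \<longlonglongrightarrow> p"
    using bounded_imp_convergent_subsequence by blast
  then have r2: "(\<lambda>n. z (Suc (r n))) \<longlonglongrightarrow> p" by (simp add: comp_def)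
  note r = r1 r2
  have p: "sol p" by (rule limit_point_is_solution[OF s A lam r])
  obtain L where L: "energy p \<longlonglongrightarrow> L" using energy_convergent[OF p] .
  have "(\<lambda>n. z (Suc (r n)) - zbar (Suc (r n))) \<longlonglongrightarrow> 0"
    using LIMSEQ_subseq_LIMSEQ[OF LIMSEQ_Suc[OF z_minus_zbar_tendsto_0[OF s]] r(1)] by (simp add: comp_def)
  from tendsto_diff[OF r(2) this] have "(\<lambda>n. zbar (Suc (r n))) \<longlonglongrightarrow> p" by simp
  then have "(\<lambda>n. phi / (phi - 1) * q (zbar (Suc (r n)) - p) + (\<beta> (r n))\<^sup>2 / 2)
      \<longlonglongrightarrow> phi / (phi - 1) * q (p - p) + 0 / 2"
    using LIMSEQ_subseq_LIMSEQ[OF \<beta>_tendsto_0[OF s] r(1)]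
    by (intro tendsto_add tendsto_mult tendsto_divide tendsto_inner_wrt[OF W] tendsto_diff tendsto_const)
      (auto simp: comp_def)
  then have "(energy p \<circ> r) \<longlonglongrightarrow> 0" by (simp add: comp_def energy_def W)
  with LIMSEQ_subseq_LIMSEQ[OF L r(1)] have "L = 0" by (rule LIMSEQ_unique)
  with L have E: "energy p \<longlonglongrightarrow> 0" by simp
  have le: "q (zbar (Suc n) - p) \<le> energy p n" for n
  proof -
    have "1 * q (zbar (Suc n) - p) \<le> phi / (phi - 1) * q (zbar (Suc n) - p)"
      using phi_gt_1 by (intro mult_right_mono) (auto simp: W)
    then show ?thesis by (simp add: energy_def add_increasing2)
  qed
  have "(\<lambda>n. q (zbar (Suc n) - p)) \<longlonglongrightarrow> 0"
    by (rule tendsto_sandwich[OF _ _ tendsto_const E]) (auto simp: W le)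
  then have "(\<lambda>n. zbar (Suc n) - p) \<longlonglongrightarrow> 0" by (rule tendsto_0_of_inner_wrt[OF W])
  then have zbar: "zbar \<longlonglongrightarrow> p" by (rule LIMSEQ_imp_Suc[OF LIM_zero_cancel])
  from tendsto_add[OF z_minus_zbar_tendsto_0[OF s] zbar] have "z \<longlonglongrightarrow> p" by simp
  with zbar p show ?thesis by blast
qed

end

section \<open>Preconditioning\<close>

text \<open>Symmetry of the composition and of its factors gives \<open>M (P x) \<bullet> v = x
  \<bullet> M (P v) = P (M x) \<bullet> v\<close>.\<close>

lemma commuting_spd:
  assumes M: "sym_pos_def M" and P: "sym_pos_def P" and MP: "sym_pos_def (M \<circ> P)"
  shows "M (P x) = P (M x)"
proof -
  have "M (P x) \<bullet> v = P (M x) \<bullet> v" for v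
    using M P MP unfolding sym_pos_def_def by (metis comp_apply inner_commute)
  then show ?thesis by (metis vector_eq_rdot)
qed

text \<open>Transfers monotonicity and the variational inequality from \<open>F\<close> and
  \<open>P\<close> to \<open>inv M \<circ> F\<close> and \<open>M \<circ> P\<close>; commuting the
  factors lets \<open>M\<close> meet its inverse.\<close>

lemma inner_wrt_preconditioned:
  fixes M P :: "'a::euclidean_space \<Rightarrow> 'a"
  assumes M: "sym_pos_def M" and P: "sym_pos_def P" and MP: "sym_pos_def (M \<circ> P)"
  shows "inner_wrt (M \<circ> P) (inv M x) v = inner_wrt P x v"
  by (simp add: inner_wrt_def commuting_spd[OF assms] sym_pos_def_inv[OF M])

lemma norm_wrt_square:
  fixes W :: "'a::euclidean_space \<Rightarrow> 'a"
  assumes "sym_pos_def W"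
  shows "(norm_wrt W x)\<^sup>2 = inner_wrt W x x"
  using inner_wrt_nonneg[OF assms] by (simp add: norm_wrt_def)

text \<open>Identifies the denominator of the step size rule as a squared \<open>M \<circ> P\<close>
  norm of a difference of values of \<open>inv M \<circ> F\<close>.\<close>

lemma norm_wrt_inv_square:
  fixes M P :: "'a::euclidean_space \<Rightarrow> 'a"
  assumes M: "sym_pos_def M" and P: "sym_pos_def P" and MP: "sym_pos_def (M \<circ> P)"
  shows "(norm_wrt (inv M \<circ> P) x)\<^sup>2 = inner_wrt (M \<circ> P) (inv M x) (inv M x)"
proof -
  have "inv M (P x) = P (inv M x)"
    by (metis commuting_spd[OF assms] sym_pos_def_inv[OF M])
  then have "inner_wrt (inv M \<circ> P) x x = inv M x \<bullet> P x"
    using P by (simp add: inner_wrt_def sym_pos_def_def)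
  also have "\<dots> = inner_wrt (M \<circ> P) (inv M x) (inv M x)"
    using inner_wrt_preconditioned[OF assms, of x "inv M x"] by (simp add: inner_wrt_def inner_commute)
  finally show ?thesis using inner_wrt_nonneg[OF MP] by (simp add: norm_wrt_def)
qed

lemma linear_inv_spd:
  fixes M :: "'a::euclidean_space \<Rightarrow> 'a"
  assumes "sym_pos_def M"
  shows "linear (inv M)"
  using assms sym_pos_def_bij[OF assms] inj_linear_imp_inv_linear
  by (auto simp: sym_pos_def_def bij_def)

lemma locally_lipschitz_on_linear_comp:
  fixes T :: "'a::euclidean_space \<Rightarrow> 'b::real_normed_vector"
  assumes T: "linear T" and h: "locally_lipschitz_on D h"
  shows "locally_lipschitz_on D (T \<circ> h)"
proof -
  have "bounded_linear T" using T by (simp add: linear_conv_bounded_linear)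
  then have "\<exists>B. B-lipschitz_on X T" for X by (meson bounded_linear.lipschitz_boundE)
  then show ?thesis
    using h unfolding locally_lipschitz_on_def by (meson lipschitz_on_compose)
qed

text \<open>Passage from the extended real minimum to real inequalities. The third fact is
  multiplied by \<open>y\<close> so that it survives \<open>y = 0\<close>, where the quotient is
  infinite and drops out of the minimum.\<close>

lemma step_size_cases:
  assumes l: "ereal l = Min {ereal a, ereal c * quot x y, ereal b}"
    and c: "c > 0" and y: "y \<ge> 0" and x: "x \<ge> 0"
  shows "l \<le> a" "l \<le> b" "l * y \<le> c * x" "l = a \<or> l = b \<or> y \<noteq> 0 \<and> l = c * (x / y)"
proof -
  have "l \<le> a \<and> l \<le> b \<and> l * y \<le> c * x \<and> (l = a \<or> l = b \<or> y \<noteq> 0 \<and> l = c * (x / y))"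
  proof (cases "y = 0")
    case True
    then have "ereal l = ereal (min a b)" using l c by (simp add: quot_def min_def)
    then show ?thesis using True c x by (auto simp: min_def)
  next
    case False
    then have "ereal l = ereal (min a (min (c * (x / y)) b))" using l by (simp add: quot_def min_def)
    then have l': "l = min a (min (c * (x / y)) b)" by (rule ereal.inject[THEN iffD1])
    have "y > 0" using False y by simp
    moreover have "l \<le> c * (x / y)" by (simp add: l')
    ultimately have "l * y \<le> c * x" by (simp add: field_simps)
    then show ?thesis using False by (auto simp: l' min_def)
  qed
  then show "l \<le> a" "l \<le> b" "l * y \<le> c * x" "l = a \<or> l = b \<or> y \<noteq> 0 \<and> l = c * (x / y)" by auto
qed

section \<open>Reduction of the preconditioned scheme to the abstract iteration\<close>

lemma VI_solutions_iff:
  assumes "proper g"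
  shows "s \<in> VI_solutions P F g \<longleftrightarrow> s \<in> edom g \<and>
    (\<forall>v\<in>edom g. inner_wrt P (F s) (v - s) + real_of_ereal (g v) - real_of_ereal (g s) \<ge> 0)"
proof (cases "s \<in> edom g")
  case True
  have "0 \<le> ereal (inner_wrt P (F s) (v - s)) + (g v - g s) \<longleftrightarrow>
      (v \<in> edom g \<longrightarrow> inner_wrt P (F s) (v - s) + real_of_ereal (g v) - real_of_ereal (g s) \<ge> 0)" for v
  proof (cases "v \<in> edom g")
    case v: True
    have "ereal (inner_wrt P (F s) (v - s)) + (g v - g s)
        = ereal (inner_wrt P (F s) (v - s) + real_of_ereal (g v) - real_of_ereal (g s))"
      by (subst ereal_real_edom[OF assms v], subst ereal_real_edom[OF assms True]) simp
    then show ?thesis using v by simp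
  next
    case False
    then have "g v = \<infinity>" by (simp add: edom_def)
    then have "ereal (inner_wrt P (F s) (v - s)) + (g v - g s) = \<infinity>"
      by (subst ereal_real_edom[OF assms True]) simp
    then show ?thesis using False by simp
  qed
  with True show ?thesis by (auto simp: VI_solutions_def)
qed (simp add: VI_solutions_def)

text \<open>\<open>MP\<close> expresses that the \<open>M \<circ> P\<close> inner product is
  meaningful, and the first two entries of \<open>init\<close> that \<open>F\<close> is meaningful
  at the initial points; the informal statement leaves both implicit.\<close>

theorem theorem5:
  fixes M P F :: "'a::euclidean_space \<Rightarrow> 'a"
    and g :: "'a \<Rightarrow> ereal"
    and z zbar :: "nat \<Rightarrow> 'a"
    and lam theta :: "nat \<Rightarrow> real"
    and phi rho lambar :: real
  assumes M: "sym_pos_def M" and P: "sym_pos_def P" and MP: "sym_pos_def (M \<circ> P)"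
    and g: "proper g" "econvex g" "lower_semicont g"
    and F: "locally_lipschitz_on (edom g) F" "monotone_wrt P (edom g) F"
    and S: "VI_solutions P F g \<noteq> {}"
    and init: "z 0 \<in> edom g" "z 1 \<in> edom g" "lam 0 > 0" "zbar 0 = z 1" "theta 0 = 1"
    and phi: "1 < phi" "phi \<le> (sqrt 5 + 1) / 2"
    and rho: "rho = 1 / phi + 1 / phi\<^sup>2"
    and lambar: "lambar > 0"
    and lam: "\<And>k. k \<ge> 1 \<Longrightarrow> ereal (lam k) =
      Min {ereal (rho * lam (k - 1)),
           ereal (phi * theta (k - 1) / (4 * lam (k - 1))) *
             quot ((norm_wrt (M \<circ> P) (z k - z (k - 1)))\<^sup>2)
                  ((norm_wrt (inv M \<circ> P) (F (z k) - F (z (k - 1))))\<^sup>2),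
           ereal lambar}"
    and zbar: "\<And>k. k \<ge> 1 \<Longrightarrow> zbar k = ((phi - 1) *\<^sub>R z k + zbar (k - 1)) /\<^sub>R phi"
    and z: "\<And>k. k \<ge> 1 \<Longrightarrow> z (k + 1) =
      prox (M \<circ> P) (\<lambda>x. ereal (lam k) * g x) (zbar k - lam k *\<^sub>R inv M (F (z k)))"
    and theta: "\<And>k. k \<ge> 1 \<Longrightarrow> theta k = phi * (lam k / lam (k - 1))"
  shows "\<exists>zs \<in> VI_solutions P F g. z \<longlonglongrightarrow> zs \<and> zbar \<longlonglongrightarrow> zs"
proof -
  define W where "W = M \<circ> P"
  define A where "A = inv M \<circ> F"
  define D where "D = edom g"
  define f where "f = (\<lambda>x. real_of_ereal (g x))"
  define q where "q v = inner_wrt W v v" for v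
  have W: "sym_pos_def W" using MP by (simp add: W_def)
  interpret closed_convex_function D f
    unfolding D_def f_def by (rule closed_convex_function_edom[OF g])
  have A_diff: "A u - A v = inv M (F u - F v)" for u v
    by (simp add: A_def linear_diff[OF linear_inv_spd[OF M]])
  have A_inner: "inner_wrt W (A u) v = inner_wrt P (F u) v" for u v
    by (simp add: A_def W_def inner_wrt_preconditioned[OF M P MP])
  have lamS: "ereal (lam (Suc k)) = Min {ereal (rho * lam k),
      ereal (phi * theta k / (4 * lam k)) * quot (q (z (Suc k) - z k)) (q (A (z (Suc k)) - A (z k))),
      ereal lambar}" for k
    using lam[of "Suc k"]
    by (simp only: A_diff q_def W_def norm_wrt_square[OF MP] norm_wrt_inv_square[OF M P MP]) simp
  have q_nonneg: "q v \<ge> 0" for v by (simp add: q_def W)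
  have rho_pos: "rho > 0" using phi(1) by (simp add: rho add_pos_pos)
  have thetaS: "theta (Suc k) = phi * (lam (Suc k) / lam k)" for k using theta[of "Suc k"] by simp
  \<comment> \<open>Each new step size uses the previous \<open>theta\<close>, so both signs are
    proved together. In the quotient case a nonzero denominator forces
    \<open>z (Suc k) \<noteq> z k\<close>, which makes the numerator positive too.\<close>
  have pos: "lam k > 0 \<and> theta k > 0" for k
  proof (induction k)
    case 0
    show ?case using init by simp
  next
    case (Suc k)
    then have c: "phi * theta k / (4 * lam k) > 0" using phi(1) by simp
    have "q (z (Suc k) - z k) / q (A (z (Suc k)) - A (z k)) > 0" if "q (A (z (Suc k)) - A (z k)) \<noteq> 0"
    proof -
      have "z (Suc k) \<noteq> z k" using that by (auto simp: q_def W)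
      then have "q (z (Suc k) - z k) > 0" unfolding q_def by (intro inner_wrt_pos[OF W]) simp
      moreover have "q (A (z (Suc k)) - A (z k)) > 0"
        using that q_nonneg[of "A (z (Suc k)) - A (z k)"] by linarith
      ultimately show ?thesis by simp
    qed
    then have "lam (Suc k) > 0"
      using step_size_cases(4)[OF lamS c q_nonneg q_nonneg] Suc c rho_pos lambar
      by (metis mult_pos_pos)
    then show ?case using Suc phi(1) by (simp add: thetaS)
  qed
  have c_pos: "phi * theta k / (4 * lam k) > 0" for k using pos[of k] phi(1) by simp
  note steps = step_size_cases[OF lamS c_pos q_nonneg q_nonneg]
  have z_prox: "z (Suc (Suc k)) \<in> D \<and> (\<forall>v\<in>D.
      inner_wrt W (zbar (Suc k) - lam (Suc k) *\<^sub>R A (z (Suc k)) - z (Suc (Suc k))) (v - z (Suc (Suc k)))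
        \<le> lam (Suc k) * (f v - f (z (Suc (Suc k)))))" for k
    using z[of "Suc k"] prox_variational_inequality[OF MP g, of "lam (Suc k)"] pos[of "Suc k"]
    by (simp add: W_def A_def D_def f_def)
  have z_in_D: "z k \<in> D" for k
    using init(1,2) z_prox by (metis D_def One_nat_def not0_implies_Suc)
  have zbar_Suc: "phi *\<^sub>R zbar (Suc k) = (phi - 1) *\<^sub>R z (Suc k) + zbar k" for k
    using zbar[of "Suc k"] phi(1) by simp
  have zbar_in_D: "zbar k \<in> D" for k
  proof (induction k)
    case 0
    show ?case using init z_in_D[of 1] by simp
  next
    case (Suc k)
    have "((phi - 1) / phi) *\<^sub>R z (Suc k) + (1 / phi) *\<^sub>R zbar k \<in> D"
      using Suc z_in_D phi(1) convex_on_imp_convex[OF convex]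
      by (intro convexD) (auto simp: field_simps)
    also have "((phi - 1) / phi) *\<^sub>R z (Suc k) + (1 / phi) *\<^sub>R zbar k = zbar (Suc k)"
      using zbar[of "Suc k"] phi(1) by (simp add: scaleR_add_right divide_inverse mult.commute)
    finally show ?case .
  qed
  interpret golden_ratio_iteration D f W A z zbar lam theta phi
  proof
    show "inner_wrt W (A u - A v) (u - v) \<ge> 0" if "u \<in> D" "v \<in> D" for u v
      using F(2) that by (simp add: A_diff W_def inner_wrt_preconditioned[OF M P MP] monotone_wrt_def D_def)
    fix k
    show "theta (Suc k) * lam k = phi * lam (Suc k)" using pos[of k] by (simp add: thetaS)
    have "lam (Suc k) \<le> rho * lam k" by (rule steps(1))
    then have "phi * (lam (Suc k) / lam k) \<le> phi * rho"
      using pos[of k] phi(1) by (intro mult_left_mono) (auto simp: field_simps)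
    also have "phi * rho = 1 + 1 / phi" using phi(1) by (simp add: rho field_simps power2_eq_square)
    finally show "theta (Suc k) \<le> 1 + 1 / phi" by (simp add: thetaS)
    let ?dA = "q (A (z (Suc k)) - A (z k))" and ?dz = "q (z (Suc k) - z k)"
    \<comment> \<open>The factor \<open>4 * lam (Suc k)\<close> turns the coefficient on the right
      into \<open>theta (Suc k) * theta k\<close>.\<close>
    have "4 * lam (Suc k) * (lam (Suc k) * ?dA) \<le> 4 * lam (Suc k) * (phi * theta k / (4 * lam k) * ?dz)"
      using pos[of "Suc k"] by (intro mult_left_mono steps(3)) auto
    also have "\<dots> = theta (Suc k) * theta k * ?dz"
      using pos[of k] by (simp add: thetaS field_simps)
    finally show "4 * (lam (Suc k))\<^sup>2 * inner_wrt W (A (z (Suc k)) - A (z k)) (A (z (Suc k)) - A (z k))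
        \<le> theta (Suc k) * theta k * inner_wrt W (z (Suc k) - z k) (z (Suc k) - z k)"
      by (simp add: q_def power2_eq_square mult.assoc)
  qed (use W phi(1) z_in_D zbar_in_D pos zbar_Suc z_prox in auto)
  have sol_iff: "sol s \<longleftrightarrow> s \<in> VI_solutions P F g" for s
    unfolding sol_def VI_solutions_iff[OF g(1)] A_inner unfolding D_def f_def ..
  obtain s where s: "sol s" using S sol_iff by blast
  have A_lip: "locally_lipschitz_on D A"
    unfolding A_def D_def by (rule locally_lipschitz_on_linear_comp[OF linear_inv_spd[OF M] F(1)])
  \<comment> \<open>The golden ratio bound amounts to \<open>phi\<^sup>2 \<le> phi + 1\<close>, that
    is \<open>rho \<ge> 1\<close>; so the first entry of the minimum never shrinks the step, as
    \<open>lam_bounded_below\<close> requires.\<close>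
  have "(2 * phi - 1)\<^sup>2 \<le> (sqrt 5)\<^sup>2" using phi by (intro power_mono) auto
  then have "phi * phi \<le> phi + 1" by (simp add: power2_eq_square algebra_simps)
  then have "rho \<ge> 1" using phi(1) by (simp add: rho field_simps power2_eq_square)
  then have "rho * lam k \<ge> lam k" for k using pos[of k] mult_right_mono[of 1 rho "lam k"] by simp
  then have cases: "lam (Suc k) \<ge> lam k \<or> lam (Suc k) = lambar \<or>
       q (A (z (Suc k)) - A (z k)) \<noteq> 0 \<and> lam (Suc k) = phi * theta k / (4 * lam k) *
         (q (z (Suc k) - z k) / q (A (z (Suc k)) - A (z k)))" for k
    using steps(4)[of k] by metis
  obtain m where m: "m > 0" "\<And>k. lam (Suc k) \<ge> m"
    using lam_bounded_below[OF s A_lip lambar steps(2) cases[unfolded q_def]] by blast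
  show ?thesis
    using converges_to_solution[OF s continuous_on_of_locally_lipschitz_on[OF A_lip] m] sol_iff by blast
qed

end
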